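(* Let $\mathcal L=\{R_1,R_2,\dots\}$, where each $R_k$ is a relation symbol of arity $k$. Then the relation of isometric isomorphism between compact metric $\mathcal L$-structures is smooth.
   Context: A compact metric $\mathcal L$-structure is a tuple $(M,d,(R_k^{\mathcal M})_k)$ where $(M,d)$ is a compact metric space and each $R_k^{\mathcal M}$ is a closed subset of $M^k$. An isometric isomorphism between two such structures is a bijection $\phi\colon M\to N$ with $\phi$ and $\phi^{-1}$ isometries such that for all $k$ and $x_1,\dots,x_k\in M$, $(x_1,\dots,x_k)\in R_k^{\mathcal M}\iff(\phi(x_1),\dots,\phi(x_k))\in R_k^{\mathcal N}$. Compact metric structures are parametrized as compact subsets of the Urysohn metric space $\mathbb U$ equipped with closed (compact) relations, giving a standard Borel space. An equivalence relation $E$ on a standard Borel space $X$ is smooth if there is a Borel map $f$ from $X$ into a Polish space with $xEy\iff f(x)=f(y)$. *)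

theory Defs
  imports "HOL-Analysis.Analysis"
begin

section \<open>Descriptive set theory\<close>

definition polish_topology :: "'a topology \<Rightarrow> bool" where
  "polish_topology T \<longleftrightarrow> completely_metrizable_space T \<and> second_countable T"

definition borel_of :: "'a topology \<Rightarrow> 'a measure" where
  "borel_of T = sigma (topspace T) {U. openin T U}"

definition standard_borel :: "'a measure \<Rightarrow> bool" where
  "standard_borel X \<longleftrightarrow>
     (\<exists>T. polish_topology T \<and> space X = topspace T \<and> sets X = sets (borel_of T))"

text \<open>The Polish space in which the invariants live is an arbitrary Polish topology on an
  arbitrary subset of \<^typ>\<open>nat \<Rightarrow> real\<close>. Since HOL cannot quantify over types, a carrier type has
  to be fixed; nothing is lost, because a Polish space has at most continuum many points, so each
  is homeomorphic to one of this form.\<close>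

definition smooth_equivalence :: "'a measure \<Rightarrow> ('a \<times> 'a) set \<Rightarrow> bool" where
  "smooth_equivalence X E \<longleftrightarrow>
     standard_borel X \<and> equiv (space X) E \<and>
     (\<exists>(T :: (nat \<Rightarrow> real) topology) f.
        polish_topology T \<and> f \<in> X \<rightarrow>\<^sub>M borel_of T \<and>
        (\<forall>x \<in> space X. \<forall>y \<in> space X. (x, y) \<in> E \<longleftrightarrow> f x = f y))"

text \<open>The hyperspace of all compact subsets (including the empty set, which is an isolated point)
  with the Vietoris topology.\<close>

definition vietoris :: "'a topology \<Rightarrow> 'a set topology" where
  "vietoris X = topology_generated_by
     ({{K. compactin X K \<and> K \<subseteq> U} | U. openin X U} \<union>
      {{K. compactin X K \<and> K \<inter> U \<noteq> {}} | U. openin X U})"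

lemma topspace_vietoris: "topspace (vietoris X) = {K. compactin X K}"
proof
  show "topspace (vietoris X) \<subseteq> {K. compactin X K}"
    by (auto simp: vietoris_def)
  have "openin (vietoris X) {K. compactin X K \<and> K \<subseteq> topspace X}"
    unfolding vietoris_def
    by (rule topology_generated_by_Basis, rule UnI1, rule CollectI, rule exI[of _ "topspace X"]) simp
  then show "{K. compactin X K} \<subseteq> topspace (vietoris X)"
    using openin_subset compactin_subset_topspace by fastforce
qed


section \<open>The Urysohn space\<close>

text \<open>Completeness and separability are carried by the class \<^class>\<open>polish_space\<close>. Universality
  quantifies over all separable metric spaces carried by subsets of \<^typ>\<open>real\<close>, which covers
  all of them up to isometry, since they have at most continuum many points.\<close>

definition urysohn_space :: "'u::polish_space itself \<Rightarrow> bool" where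
  "urysohn_space _ \<longleftrightarrow>
     (\<forall>(M :: real set) d.
        Metric_space M d \<and> separable_space (Metric_space.mtopology M d) \<longrightarrow>
        (\<exists>f :: real \<Rightarrow> 'u. \<forall>x \<in> M. \<forall>y \<in> M. dist (f x) (f y) = d x y)) \<and>
     (\<forall>(A :: 'u set) (f :: 'u \<Rightarrow> 'u).
        finite A \<and> (\<forall>x \<in> A. \<forall>y \<in> A. dist (f x) (f y) = dist x y) \<longrightarrow>
        (\<exists>g :: 'u \<Rightarrow> 'u. surj g \<and> (\<forall>x y. dist (g x) (g y) = dist x y) \<and> (\<forall>x \<in> A. g x = f x)))"


section \<open>Compact metric structures\<close>

text \<open>The power \<open>M\<^sup>k\<close> consists of the extensional functions \<open>{1..k} \<rightarrow> M\<close>, with the product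
  topology. A structure is coded by its universe \<open>M\<close>, a compact subset of the Urysohn space (whose
  metric it inherits), and the sequence of its relations \<open>R k\<close> for \<open>k \<ge> 1\<close>; extensionality of
  \<open>R\<close> fixes the irrelevant value at \<open>0\<close>, so that different codes are different structures.\<close>

abbreviation power_topology :: "'a topology \<Rightarrow> nat \<Rightarrow> (nat \<Rightarrow> 'a) topology" where
  "power_topology X k \<equiv> product_topology (\<lambda>_. X) {1..k}"

type_synonym 'u structure_code = "'u set \<times> (nat \<Rightarrow> (nat \<Rightarrow> 'u) set)"

definition compact_structures :: "'u::metric_space structure_code set" where
  "compact_structures =
     {(M, R). compact M \<and> R \<in> extensional {1..} \<and>
        (\<forall>k\<ge>1. closedin (power_topology (top_of_set M) k) (R k))}"

definition structure_topology :: "'u::metric_space structure_code topology" where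
  "structure_topology =
     subtopology
       (prod_topology (vietoris euclidean)
          (product_topology (\<lambda>k. vietoris (power_topology euclidean k)) {1..}))
       compact_structures"

lemma topspace_structure_topology: "topspace structure_topology = compact_structures"
proof -
  have closed: "compactin (power_topology euclidean k) S"
    if M: "compact M" and S: "closedin (power_topology (top_of_set M) k) S"
    for M :: "'u::metric_space set" and k S
  proof -
    have "compact_space (power_topology (top_of_set M) k)"
      using M by (simp add: compact_space_product_topology compact_space_subtopology)
    then have "compactin (power_topology (top_of_set M) k) S"
      using S by (rule closedin_compact_space)
    then show ?thesis
      unfolding subtopology_product_topology[of "\<lambda>_. euclidean" "{1..k}" "\<lambda>_. M", symmetric]
        compactin_subtopology by (rule conjunct1)
  qed
  have "A \<in> topspace (prod_topology (vietoris euclidean)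
      (product_topology (\<lambda>k. vietoris (power_topology euclidean k)) {1..}))"
    if "A \<in> compact_structures" for A :: "'u::metric_space structure_code"
  proof -
    obtain M R where A: "A = (M, R)" by fastforce
    have M: "compact M" and R: "R \<in> extensional {1..}"
      and cl: "\<forall>k\<ge>1. closedin (power_topology (top_of_set M) k) (R k)"
      using that unfolding A compact_structures_def by simp_all
    have "R k \<in> topspace (vietoris (power_topology euclidean k))" if "k \<in> {1..}" for k
      unfolding topspace_vietoris mem_Collect_eq
      by (rule closed[OF M], rule cl[rule_format], rule that[unfolded atLeast_iff])
    with R have "R \<in> (\<Pi>\<^sub>E k\<in>{1..}. topspace (vietoris (power_topology euclidean k)))"
      unfolding PiE_iff by blast
    then show ?thesis
      unfolding A topspace_prod_topology topspace_product_topology o_def topspace_vietoris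
        compactin_euclidean_iff
      using M by (intro SigmaI CollectI)
  qed
  then show ?thesis
    unfolding structure_topology_def topspace_subtopology by blast
qed

definition isometric_isomorphism ::
    "'u::metric_space structure_code \<Rightarrow> 'u structure_code \<Rightarrow> ('u \<Rightarrow> 'u) \<Rightarrow> bool" where
  "isometric_isomorphism = (\<lambda>(M, R) (N, S) \<phi>.
     bij_betw \<phi> M N \<and>
     (\<forall>x \<in> M. \<forall>y \<in> M. dist (\<phi> x) (\<phi> y) = dist x y) \<and>
     (\<forall>k\<ge>1. \<forall>x \<in> {1..k} \<rightarrow>\<^sub>E M. x \<in> R k \<longleftrightarrow> (\<lambda>i \<in> {1..k}. \<phi> (x i)) \<in> S k))"

definition isometric_isomorphism_relation ::
    "('u::metric_space structure_code \<times> 'u structure_code) set" where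
  "isometric_isomorphism_relation =
     {(A, B). A \<in> compact_structures \<and> B \<in> compact_structures \<and>
        (\<exists>\<phi>. isometric_isomorphism A B \<phi>)}"

end

theory Submission
  imports Defs
begin

text \<open>Codes of structures form a Polish space. A Polish space \<open>X\<close> is a \<open>G\<^sub>\<delta>\<close> in the Hilbert cube
  \<open>Q\<close>, so its hyperspace is a \<open>G\<^sub>\<delta>\<close> in that of \<open>Q\<close>, which is compact by Alexander's subbase
  theorem and embeds in \<open>\<real>\<^sup>\<omega>\<close> through the distances to the points of a countable dense set.
  Finally \<open>R k \<subseteq> M\<^sup>k\<close> is a closed condition.

  For the classification, send a sequence \<open>x\<close> in \<open>M\<close> to all distances \<open>d(x\<^sub>i, x\<^sub>j)\<close> together
  with the distances of all tuples \<open>(x\<^sub>i, \<dots>, x\<^sub>j)\<close> to the relations \<open>R k\<close>. The set of all these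
  profiles is a compact invariant. If a dense sequence of one structure has the same profile as some
  sequence of another, then the first structure embeds isometrically in the second, respecting the
  relations in both directions. Two structures with the same profiles thus embed in each other, and
  since an isometric self-embedding of a compact space is onto, they are isomorphic. For open \<open>U\<close>
  the structures having a profile in \<open>U\<close> form an open set, and the sets \<open>U\<close> from a countable base
  that meet the compact set of profiles determine it, so their indicators are the required map.\<close>

section \<open>Polish spaces\<close>

lemma second_countable_euclidean:
  "second_countable (euclidean :: 'a::second_countable_topology topology)"
proof -
  obtain B :: "'a set set" where "countable B" "topological_basis B"
    using ex_countable_basis by blast
  then show ?thesis
    unfolding second_countable_def
    by (intro exI[of _ B]) (simp add: topological_basis_open, metis topological_basisE)
qed

lemma polish_topology_euclidean: "polish_topology (euclidean :: 'a::polish_space topology)"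
  by (simp add: polish_topology_def completely_metrizable_space_euclidean second_countable_euclidean)

lemma homeomorphic_polish_topology:
  "X homeomorphic_space Y \<Longrightarrow> polish_topology X \<longleftrightarrow> polish_topology Y"
  unfolding polish_topology_def
  using homeomorphic_completely_metrizable_space homeomorphic_space_second_countability by blast

lemma polish_topology_gdelta:
  "\<lbrakk>polish_topology X; gdelta_in X S\<rbrakk> \<Longrightarrow> polish_topology (subtopology X S)"
  by (simp add: polish_topology_def completely_metrizable_space_gdelta_in second_countable_subtopology)

lemma polish_topology_closedin:
  "\<lbrakk>polish_topology X; closedin X S\<rbrakk> \<Longrightarrow> polish_topology (subtopology X S)"
  by (simp add: polish_topology_def completely_metrizable_space_closedin second_countable_subtopology)

section \<open>Countable bases of products\<close>

lemma openin_product_topology_coordinate: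
  assumes "i \<in> I" and "openin (X i) V"
  shows "openin (product_topology X I) {x \<in> topspace (product_topology X I). x i \<in> V}"
  using openin_continuous_map_preimage[of _ "X i" "\<lambda>x. x i", OF _ assms(2)]
    continuous_map_product_projection[OF assms(1), of X] by blast

text \<open>A base is given by the boxes that restrict finitely many coordinates to members of
  countable bases of the factors. Such a box is coded by a finite subset of the countable set
  \<open>Sigma I B\<close>.\<close>

lemma second_countable_product_topology:
  assumes "countable I" and "\<And>i. i \<in> I \<Longrightarrow> second_countable (X i)"
  shows "second_countable (product_topology X I)"
proof -
  obtain B where B: "\<And>i. i \<in> I \<Longrightarrow> countable (B i)" "\<And>i V. i \<in> I \<Longrightarrow> V \<in> B i \<Longrightarrow> openin (X i) V"
    "\<And>i U x. i \<in> I \<Longrightarrow> openin (X i) U \<Longrightarrow> x \<in> U \<Longrightarrow> \<exists>V\<in>B i. x \<in> V \<and> V \<subseteq> U"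
    using assms(2) unfolding second_countable_def by metis
  \<comment> \<open>The second intersection makes \<open>box {}\<close> the whole product rather
    than \<open>UNIV\<close>.\<close>
  define box where "box A = (\<Inter>(i, V)\<in>A. {x \<in> topspace (product_topology X I). x i \<in> V})
    \<inter> topspace (product_topology X I)" for A
  define K where "K = box ` {A. finite A \<and> A \<subseteq> Sigma I B}"
  have "countable (Sigma I B)"
    using assms(1) B(1) by auto
  then have "countable K"
    unfolding K_def by (intro countable_image countable_Collect_finite_subset)
  moreover have "openin (product_topology X I) W" if "W \<in> K" for W
  proof -
    obtain A where A: "finite A" "A \<subseteq> Sigma I B" "W = box A"
      using \<open>W \<in> K\<close> unfolding K_def by blast
    have "openin (product_topology X I) (box A)"
      using A(1,2)
    proof (induction A)
      case empty
      then show ?case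
        by (simp add: box_def del: topspace_product_topology)
    next
      case (insert a A)
      obtain i V where a: "a = (i, V)" and V: "i \<in> I" "openin (X i) V"
        using insert.prems B(2) by auto
      have "openin (product_topology X I) {x \<in> topspace (product_topology X I). x i \<in> V}"
        using V by (rule openin_product_topology_coordinate)
      moreover have "box (insert a A) = {x \<in> topspace (product_topology X I). x i \<in> V} \<inter> box A"
        by (auto simp: box_def a)
      ultimately show ?case
        using insert openin_Int by fastforce
    qed
    then show ?thesis
      using A by simp
  qed
  moreover have "\<exists>V\<in>K. x \<in> V \<and> V \<subseteq> W" if "openin (product_topology X I) W" "x \<in> W" for W x
  proof -
    obtain U where U: "finite {i \<in> I. U i \<noteq> topspace (X i)}" "\<And>i. i \<in> I \<Longrightarrow> openin (X i) (U i)"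
      "x \<in> Pi\<^sub>E I U" "Pi\<^sub>E I U \<subseteq> W"
      using \<open>openin (product_topology X I) W\<close>[unfolded openin_product_topology_alt, rule_format, OF \<open>x \<in> W\<close>]
      by blast
    \<comment> \<open>Only the finitely many coordinates in \<open>J\<close> have to be restricted;
      elsewhere \<open>U i\<close> is the whole factor.\<close>
    define J where "J = {i \<in> I. U i \<noteq> topspace (X i)}"
    have "\<exists>V\<in>B i. x i \<in> V \<and> V \<subseteq> U i" if "i \<in> I" for i
      using U B(3) that by (simp add: PiE_mem)
    then obtain V where V: "\<And>i. i \<in> I \<Longrightarrow> V i \<in> B i \<and> x i \<in> V i \<and> V i \<subseteq> U i"
      by metis
    have x: "x \<in> topspace (product_topology X I)"
      using that openin_subset by blast
    have "box ((\<lambda>i. (i, V i)) ` J) \<in> K"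
      unfolding K_def using U(1) V by (auto simp: J_def)
    moreover have "x \<in> box ((\<lambda>i. (i, V i)) ` J)"
      using x V by (auto simp: box_def J_def)
    moreover have "box ((\<lambda>i. (i, V i)) ` J) \<subseteq> Pi\<^sub>E I U"
    proof
      fix y assume y: "y \<in> box ((\<lambda>i. (i, V i)) ` J)"
      then have "y \<in> topspace (product_topology X I)"
        by (simp add: box_def)
      moreover have "y i \<in> U i" if "i \<in> J" for i
        using y that V by (fastforce simp: box_def J_def)
      ultimately show "y \<in> Pi\<^sub>E I U"
        unfolding topspace_product_topology PiE_iff J_def by blast
    qed
    ultimately show ?thesis
      using U(4) by (meson order_trans)
  qed
  ultimately show ?thesis
    unfolding second_countable_def by (intro exI[of _ K]) simp
qed

lemma polish_topology_product_topology:
  assumes "countable I" and "\<And>i. i \<in> I \<Longrightarrow> polish_topology (X i)"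
  shows "polish_topology (product_topology X I)"
  using assms
  by (simp add: polish_topology_def completely_metrizable_space_product_topology
      second_countable_product_topology)

lemma polish_topology_prod_topology:
  assumes "polish_topology X" and "polish_topology Y"
  shows "polish_topology (prod_topology X Y)"
proof -
  obtain \<B> \<C> where \<B>: "countable \<B>" "\<And>V. V \<in> \<B> \<Longrightarrow> openin X V"
      "\<And>U x. openin X U \<Longrightarrow> x \<in> U \<Longrightarrow> \<exists>V \<in> \<B>. x \<in> V \<and> V \<subseteq> U"
    and \<C>: "countable \<C>" "\<And>V. V \<in> \<C> \<Longrightarrow> openin Y V"
      "\<And>U x. openin Y U \<Longrightarrow> x \<in> U \<Longrightarrow> \<exists>V \<in> \<C>. x \<in> V \<and> V \<subseteq> U"
    using assms unfolding polish_topology_def second_countable_def by metis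
  have "second_countable (prod_topology X Y)"
    unfolding second_countable_def
  proof (intro exI[of _ "(\<lambda>(U, V). U \<times> V) ` (\<B> \<times> \<C>)"] conjI ballI allI impI)
    fix W z assume "openin (prod_topology X Y) W \<and> z \<in> W"
    then obtain U V where "openin X U" "openin Y V" "fst z \<in> U" "snd z \<in> V" "U \<times> V \<subseteq> W"
      unfolding openin_prod_topology_alt by (metis prod.collapse)
    then show "\<exists>V\<in>(\<lambda>(U, V). U \<times> V) ` (\<B> \<times> \<C>). z \<in> V \<and> V \<subseteq> W"
    proof -
      obtain U' V' where UV: "U' \<in> \<B>" "fst z \<in> U'" "U' \<subseteq> U" "V' \<in> \<C>" "snd z \<in> V'" "V' \<subseteq> V"
        using \<B>(3)[OF \<open>openin X U\<close> \<open>fst z \<in> U\<close>] \<C>(3)[OF \<open>openin Y V\<close> \<open>snd z \<in> V\<close>] by auto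
      then have "z \<in> U' \<times> V'" "U' \<times> V' \<subseteq> W"
        using \<open>U \<times> V \<subseteq> W\<close> by (auto simp: mem_Times_iff)
      with UV show ?thesis
        by (intro bexI[of _ "U' \<times> V'"]) auto
    qed
  qed (use \<B> \<C> in \<open>auto simp: openin_prod_Times_iff\<close>)
  with assms show ?thesis
    by (simp add: polish_topology_def completely_metrizable_space_prod_topology)
qed


section \<open>The hyperspace of compact sets\<close>

lemma openin_vietoris_subset:
  assumes "openin X U"
  shows "openin (vietoris X) {K. compactin X K \<and> K \<subseteq> U}"
  unfolding vietoris_def by (rule topology_generated_by_Basis) (use assms in blast)

lemma openin_vietoris_meets:
  assumes "openin X U"
  shows "openin (vietoris X) {K. compactin X K \<and> K \<inter> U \<noteq> {}}"
  unfolding vietoris_def by (rule topology_generated_by_Basis) (use assms in blast)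

lemma continuous_map_vietoris:
  assumes "\<And>z. z \<in> topspace T \<Longrightarrow> compactin X (f z)"
    and "\<And>U. openin X U \<Longrightarrow> openin T {z \<in> topspace T. f z \<subseteq> U}"
    and "\<And>U. openin X U \<Longrightarrow> openin T {z \<in> topspace T. f z \<inter> U \<noteq> {}}"
  shows "continuous_map T (vietoris X) f"
  unfolding vietoris_def
proof (rule continuous_on_generated_topo)
  fix \<U> assume "\<U> \<in> {{K. compactin X K \<and> K \<subseteq> U} | U. openin X U} \<union>
      {{K. compactin X K \<and> K \<inter> U \<noteq> {}} | U. openin X U}"
  then obtain U where U: "openin X U"
    and "\<U> = {K. compactin X K \<and> K \<subseteq> U} \<or> \<U> = {K. compactin X K \<and> K \<inter> U \<noteq> {}}"
    by blast
  then have "f -` \<U> \<inter> topspace T = {z \<in> topspace T. f z \<subseteq> U} \<or>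
      f -` \<U> \<inter> topspace T = {z \<in> topspace T. f z \<inter> U \<noteq> {}}"
    using assms(1) by blast
  then show "openin T (f -` \<U> \<inter> topspace T)"
    using assms(2,3) U by auto
next
  show "f ` topspace T \<subseteq> \<Union> ({{K. compactin X K \<and> K \<subseteq> U} | U. openin X U} \<union>
      {{K. compactin X K \<and> K \<inter> U \<noteq> {}} | U. openin X U})"
    unfolding topology_generated_by_topspace[symmetric] vietoris_def[symmetric] topspace_vietoris
    using assms(1) by blast
qed

text \<open>For compact \<open>K\<close>, the image of \<open>K\<close> lies in or meets
  \<open>U\<close> exactly when \<open>K\<close> lies in or meets the preimage of \<open>U\<close>.
  Subbasic sets thus pull back to subbasic sets.\<close>

lemma continuous_map_vietoris_image:
  assumes g: "continuous_map X Y g"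
  shows "continuous_map (vietoris X) (vietoris Y) (image g)"
proof (rule continuous_map_vietoris)
  fix U assume "openin Y U"
  then have U: "openin X {x \<in> topspace X. g x \<in> U}"
    using g openin_continuous_map_preimage by blast
  have "{K \<in> topspace (vietoris X). g ` K \<subseteq> U}
      = {K. compactin X K \<and> K \<subseteq> {x \<in> topspace X. g x \<in> U}}"
    using compactin_subset_topspace by (fastforce simp: topspace_vietoris)
  then show "openin (vietoris X) {K \<in> topspace (vietoris X). g ` K \<subseteq> U}"
    using openin_vietoris_subset[OF U] by simp
  have "{K \<in> topspace (vietoris X). g ` K \<inter> U \<noteq> {}}
      = {K. compactin X K \<and> K \<inter> {x \<in> topspace X. g x \<in> U} \<noteq> {}}"
    using compactin_subset_topspace by (fastforce simp: topspace_vietoris)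
  then show "openin (vietoris X) {K \<in> topspace (vietoris X). g ` K \<inter> U \<noteq> {}}"
    using openin_vietoris_meets[OF U] by simp
qed (use g image_compactin in \<open>fastforce simp: topspace_vietoris\<close>)

lemma homeomorphic_space_vietoris:
  assumes "X homeomorphic_space Y"
  shows "vietoris X homeomorphic_space vietoris Y"
proof -
  obtain f g where fg: "homeomorphic_maps X Y f g"
    using assms homeomorphic_space_def by blast
  have gf: "g ` f ` K = K" if "compactin X K" for K
    using fg compactin_subset_topspace[OF that] unfolding homeomorphic_maps_def image_image
    by (simp add: subset_iff)
  have fg': "f ` g ` K = K" if "compactin Y K" for K
    using fg compactin_subset_topspace[OF that] unfolding homeomorphic_maps_def image_image
    by (simp add: subset_iff)
  have "homeomorphic_maps (vietoris X) (vietoris Y) (image f) (image g)"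
    using fg gf fg' unfolding homeomorphic_maps_def topspace_vietoris
    by (simp add: continuous_map_vietoris_image)
  then show ?thesis
    using homeomorphic_space_def by blast
qed

text \<open>The identity is a homeomorphism: compactness of a subset of \<open>S\<close> does not
  depend on the ambient space, and the subbasic sets given by \<open>V \<inter> S\<close> are traces
  of those given by \<open>V\<close>.\<close>

lemma vietoris_subtopology:
  "vietoris (subtopology X S) homeomorphic_space subtopology (vietoris X) {K. K \<subseteq> S}"
proof -
  have 1: "continuous_map (vietoris (subtopology X S)) (subtopology (vietoris X) {K. K \<subseteq> S}) id"
  proof (rule continuous_map_into_subtopology)
    show "continuous_map (vietoris (subtopology X S)) (vietoris X) id"
      using continuous_map_vietoris_image[OF continuous_map_id_subt, of X S] by simp
  qed (auto simp: topspace_vietoris compactin_subtopology)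
  have 2: "continuous_map (subtopology (vietoris X) {K. K \<subseteq> S}) (vietoris (subtopology X S)) id"
  proof (rule continuous_map_vietoris)
    fix U assume "openin (subtopology X S) U"
    then obtain V where V: "openin X V" "U = V \<inter> S"
      by (auto simp: openin_subtopology)
    have "{K \<in> topspace (subtopology (vietoris X) {K. K \<subseteq> S}). id K \<subseteq> U}
        = {K. compactin X K \<and> K \<subseteq> V} \<inter> {K. K \<subseteq> S}"
      by (auto simp: topspace_vietoris V)
    then show "openin (subtopology (vietoris X) {K. K \<subseteq> S})
        {K \<in> topspace (subtopology (vietoris X) {K. K \<subseteq> S}). id K \<subseteq> U}"
      using openin_subtopology_Int[OF openin_vietoris_subset[OF V(1)]] by simp
    have "{K \<in> topspace (subtopology (vietoris X) {K. K \<subseteq> S}). id K \<inter> U \<noteq> {}}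
        = {K. compactin X K \<and> K \<inter> V \<noteq> {}} \<inter> {K. K \<subseteq> S}"
      by (auto simp: topspace_vietoris V)
    then show "openin (subtopology (vietoris X) {K. K \<subseteq> S})
        {K \<in> topspace (subtopology (vietoris X) {K. K \<subseteq> S}). id K \<inter> U \<noteq> {}}"
      using openin_subtopology_Int[OF openin_vietoris_meets[OF V(1)]] by simp
  qed (auto simp: topspace_vietoris compactin_subtopology)
  show ?thesis
    unfolding homeomorphic_space_def homeomorphic_maps_def
    by (intro exI[of _ id] conjI 1 2) simp_all
qed

text \<open>Given a subbasic cover, let \<open>L\<close> be the complement of all open
  \<open>V\<close> for which "meets \<open>V\<close>" is a member. The member containing
  \<open>L\<close> must have the form "is contained in \<open>U\<close>". The compact complement of
  \<open>U\<close> is then covered by finitely many of the \<open>V\<close>, which yields a finite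
  subcover.\<close>

lemma compact_space_vietoris:
  assumes X: "compact_space X"
  shows "compact_space (vietoris X)"
proof -
  define \<S> where "\<S> = {{K. compactin X K \<and> K \<subseteq> U} | U. openin X U} \<union>
      {{K. compactin X K \<and> K \<inter> U \<noteq> {}} | U. openin X U}"
  have top: "\<Union>\<S> = {K. compactin X K}"
    using topspace_vietoris[of X] unfolding vietoris_def \<S>_def by simp
  show ?thesis
  proof (rule Alexander_subbase_alt[of "{K. compactin X K}" \<S>])
    fix C assume C: "C \<subseteq> \<S>" and cover: "{K. compactin X K} \<subseteq> \<Union>C"
    define \<V> where "\<V> = {V. openin X V \<and> {K. compactin X K \<and> K \<inter> V \<noteq> {}} \<in> C}"
    define L where "L = topspace X - \<Union>\<V>"
    have \<V>: "openin X (\<Union>\<V>)"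
      by (auto simp: \<V>_def)
    then have L: "compactin X L"
      unfolding L_def by (intro closedin_compact_space X) blast
    then obtain \<U> where \<U>: "\<U> \<in> C" "L \<in> \<U>"
      using cover by blast
    \<comment> \<open>\<open>L\<close> is disjoint from each set in \<open>\<V>\<close>, so a member
      of the cover that contains \<open>L\<close> cannot be a meeting condition.\<close>
    have "\<nexists>V. openin X V \<and> \<U> = {K. compactin X K \<and> K \<inter> V \<noteq> {}}"
      using \<U> by (auto simp: \<V>_def L_def)
    moreover have "\<U> \<in> \<S>"
      using C \<U>(1) by (rule subsetD)
    ultimately obtain U where U: "openin X U" "\<U> = {K. compactin X K \<and> K \<subseteq> U}"
      unfolding \<S>_def Un_iff mem_Collect_eq by metis
    have "compactin X (topspace X - U)"
      using U by (intro closedin_compact_space X) blast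
    moreover have "topspace X - U \<subseteq> \<Union>\<V>"
      using \<U>(2) U by (auto simp: L_def)
    ultimately obtain \<F> where \<F>: "finite \<F>" "\<F> \<subseteq> \<V>" "topspace X - U \<subseteq> \<Union>\<F>"
      using compactinD[of X "topspace X - U" \<V>] by (auto simp: \<V>_def)
    \<comment> \<open>A compact \<open>K\<close> that is not contained in \<open>U\<close> has a
      point outside \<open>U\<close>, hence in one of the sets in \<open>\<F>\<close>.\<close>
    have "{K. compactin X K} \<subseteq> \<Union>(insert \<U> ((\<lambda>V. {K. compactin X K \<and> K \<inter> V \<noteq> {}}) ` \<F>))"
      using \<F>(3) U compactin_subset_topspace by fastforce
    then show "\<exists>C'. finite C' \<and> C' \<subseteq> C \<and> {K. compactin X K} \<subseteq> \<Union>C'"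
      using \<F>(1,2) \<U>(1)
      by (intro exI[of _ "insert \<U> ((\<lambda>V. {K. compactin X K \<and> K \<inter> V \<noteq> {}}) ` \<F>)"])
        (auto simp: \<V>_def)
  next
    \<comment> \<open>Alexander's theorem speaks of unions of finite intersections taken relative to
      the whole space, while the generated topology is inductive. The two agree, since the empty
      intersection contributes \<open>\<Union>\<S>\<close>, which is itself a union of subbasic
      sets.\<close>
    have "topology (arbitrary union_of (finite intersection_of (\<lambda>x. x \<in> \<S>) relative_to \<Union>\<S>))
        = topology_generated_by \<S>"
    proof (intro arg_cong[where f = topology] ext iffI)
      fix U assume "(arbitrary union_of (finite intersection_of (\<lambda>x. x \<in> \<S>) relative_to \<Union>\<S>)) U"
      then obtain \<F> where \<F>: "U = \<Union>\<F>"
        "\<And>W. W \<in> \<F> \<Longrightarrow> (finite intersection_of (\<lambda>x. x \<in> \<S>) relative_to \<Union>\<S>) W"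
        unfolding union_of_def by auto
      have "generate_topology_on \<S> W" if "W \<in> \<F>" for W
      proof -
        obtain T where T: "finite T" "T \<subseteq> \<S>" "W = \<Union>\<S> \<inter> \<Inter>T"
          using \<F>(2)[OF \<open>W \<in> \<F>\<close>] unfolding relative_to_def intersection_of_def by auto
        have "generate_topology_on \<S> (\<Union>\<S> \<inter> \<Inter>T)"
          using T(1,2)
        proof (induction T)
          case empty
          then show ?case
            using generate_topology_on.UN[OF generate_topology_on.Basis] by simp
        next
          case (insert a T)
          then have "generate_topology_on \<S> (a \<inter> (\<Union>\<S> \<inter> \<Inter>T))"
            by (intro generate_topology_on.Int generate_topology_on.Basis insert.IH) simp_all
          then show ?case
            by (simp add: Int_left_commute)
        qed
        with T show ?thesis
          by simp
      qed
      then show "generate_topology_on \<S> U"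
        unfolding \<F>(1) by (rule generate_topology_on.UN)
    next
      fix U assume "generate_topology_on \<S> U"
      then obtain \<F> where \<F>: "U = \<Union>\<F>"
        "\<And>W. W \<in> \<F> \<Longrightarrow> (finite' intersection_of (\<lambda>x. x \<in> \<S>)) W"
        unfolding generate_topology_on_eq union_of_def by auto
      have "(finite intersection_of (\<lambda>x. x \<in> \<S>) relative_to \<Union>\<S>) W" if W: "W \<in> \<F>" for W
      proof -
        obtain T where T: "finite T" "T \<noteq> {}" "T \<subseteq> \<S>" "W = \<Inter>T"
          using \<F>(2)[OF W] unfolding intersection_of_def by auto
        then have "\<Union>\<S> \<inter> \<Inter>T = W"
          by blast
        with T show ?thesis
          unfolding relative_to_def intersection_of_def by auto
      qed
      then show "(arbitrary union_of (finite intersection_of (\<lambda>x. x \<in> \<S>) relative_to \<Union>\<S>)) U"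
        unfolding union_of_def using \<F> by (intro exI[of _ \<F>]) (auto simp: arbitrary_def)
    qed
    then show "topology (arbitrary union_of (finite intersection_of (\<lambda>x. x \<in> \<S>)
        relative_to {K. compactin X K})) = vietoris X"
      by (simp only: top vietoris_def \<S>_def[symmetric])
  qed (simp add: top)
qed

section \<open>Truncated distance to a set\<close>

text \<open>The truncation keeps this finite, and continuous in \<open>K\<close>, at the isolated point \<open>K = {}\<close>.\<close>

definition trunc_infdist :: "('a \<Rightarrow> 'b \<Rightarrow> real) \<Rightarrow> 'a \<Rightarrow> 'b set \<Rightarrow> real" where
  "trunc_infdist \<delta> p K = Inf (insert 1 (\<delta> p ` K))"

lemma trunc_infdist_less_iff:
  assumes "\<And>r. r \<in> K \<Longrightarrow> 0 \<le> \<delta> p r"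
  shows "trunc_infdist \<delta> p K < c \<longleftrightarrow> 1 < c \<or> (\<exists>r\<in>K. \<delta> p r < c)"
proof -
  have "bdd_below (insert 1 (\<delta> p ` K))"
    using assms by (intro bdd_belowI[of _ 0]) auto
  then show ?thesis
    unfolding trunc_infdist_def by (subst cInf_less_iff) auto
qed

lemma trunc_infdist_nonneg:
  assumes "\<And>r. r \<in> K \<Longrightarrow> 0 \<le> \<delta> p r"
  shows "0 \<le> trunc_infdist \<delta> p K"
  using trunc_infdist_less_iff[of K \<delta> p 0] assms by force

text \<open>Upper bounds are stable because a single point of \<open>K\<close> witnesses them, and
  nearby sets still meet a neighbourhood of that point. Lower bounds are stable by the tube lemma,
  as \<open>K\<close> is compact.\<close>

lemma continuous_map_trunc_infdist:
  assumes \<delta>: "continuous_map (prod_topology X Z) euclideanreal (\<lambda>(p, r). \<delta> p r)"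
    and nonneg: "\<And>p r. 0 \<le> \<delta> p r"
  shows "continuous_map (prod_topology X (vietoris Z)) euclideanreal (\<lambda>(p, K). trunc_infdist \<delta> p K)"
  unfolding continuous_map_upper_lower_semicontinuous_lt
proof (intro allI conjI)
  fix c
  let ?T = "prod_topology X (vietoris Z)"
  show "openin ?T {z \<in> topspace ?T. (case z of (p, K) \<Rightarrow> trunc_infdist \<delta> p K) < c}"
  proof (cases "1 < c")
    case True
    then have "{z \<in> topspace ?T. (case z of (p, K) \<Rightarrow> trunc_infdist \<delta> p K) < c} = topspace ?T"
      by (auto simp: trunc_infdist_less_iff nonneg)
    then show ?thesis
      by (simp only: openin_topspace)
  next
    \<comment> \<open>Now the truncation value \<open>1\<close> is not below \<open>c\<close>, so
      the witness has to be a point of \<open>K\<close>.\<close>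
    case False
    let ?W = "{z \<in> topspace (prod_topology X Z). (case z of (p, r) \<Rightarrow> \<delta> p r) < c}"
    have W: "openin (prod_topology X Z) ?W"
      using \<delta> unfolding continuous_map_upper_lower_semicontinuous_lt by blast
    show ?thesis
    proof (subst openin_subopen, intro ballI)
      fix z assume z: "z \<in> {z \<in> topspace ?T. (case z of (p, K) \<Rightarrow> trunc_infdist \<delta> p K) < c}"
      obtain p K where pK: "z = (p, K)" by fastforce
      then have "p \<in> topspace X" "compactin Z K"
        using z by (auto simp: topspace_vietoris)
      obtain r where r: "r \<in> K" "\<delta> p r < c"
        using z False by (auto simp: pK trunc_infdist_less_iff nonneg)
      then have "(p, r) \<in> ?W"
        using \<open>p \<in> topspace X\<close> compactin_subset_topspace[OF \<open>compactin Z K\<close>] by auto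
      then obtain U V where UV: "openin X U" "openin Z V" "p \<in> U" "r \<in> V" "U \<times> V \<subseteq> ?W"
        using W unfolding openin_prod_topology_alt by meson
      show "\<exists>T. openin ?T T \<and> z \<in> T \<and> T \<subseteq> {z \<in> topspace ?T. (case z of (p, K) \<Rightarrow> trunc_infdist \<delta> p K) < c}"
      proof (intro exI[of _ "U \<times> {K. compactin Z K \<and> K \<inter> V \<noteq> {}}"] conjI)
        show "openin ?T (U \<times> {K. compactin Z K \<and> K \<inter> V \<noteq> {}})"
          using UV openin_vietoris_meets[OF UV(2)] by (simp add: openin_prod_Times_iff)
        show "z \<in> U \<times> {K. compactin Z K \<and> K \<inter> V \<noteq> {}}"
          using UV r \<open>compactin Z K\<close> by (auto simp: pK)
        show "U \<times> {K. compactin Z K \<and> K \<inter> V \<noteq> {}}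
            \<subseteq> {z \<in> topspace ?T. (case z of (p, K) \<Rightarrow> trunc_infdist \<delta> p K) < c}"
          using UV(5) openin_subset[OF UV(1)]
          by (fastforce simp: trunc_infdist_less_iff nonneg topspace_vietoris)
      qed
    qed
  qed
next
  fix c
  let ?T = "prod_topology X (vietoris Z)"
  show "openin ?T {z \<in> topspace ?T. c < (case z of (p, K) \<Rightarrow> trunc_infdist \<delta> p K)}"
  proof (subst openin_subopen, intro ballI)
    fix z assume z: "z \<in> {z \<in> topspace ?T. c < (case z of (p, K) \<Rightarrow> trunc_infdist \<delta> p K)}"
    obtain p K where pK: "z = (p, K)" by fastforce
    then have p: "p \<in> topspace X" and K: "compactin Z K" and c: "c < trunc_infdist \<delta> p K"
      using z by (auto simp: topspace_vietoris)
    \<comment> \<open>A pointwise bound by \<open>b\<close> on a neighbourhood only bounds the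
      infimum weakly from below; the gap between \<open>c\<close> and \<open>b\<close> restores
      strictness.\<close>
    obtain b where b: "c < b" "b < trunc_infdist \<delta> p K"
      using c dense by blast
    have b1: "b < 1" and bK: "\<And>r. r \<in> K \<Longrightarrow> b < \<delta> p r"
    proof -
      obtain b' where b': "b < b'" "b' < trunc_infdist \<delta> p K"
        using b dense by blast
      have "\<not> trunc_infdist \<delta> p K < b'"
        using b' by simp
      then have "b' \<le> 1" "\<And>r. r \<in> K \<Longrightarrow> b' \<le> \<delta> p r"
        by (auto simp: trunc_infdist_less_iff nonneg not_less)
      then show "b < 1" "\<And>r. r \<in> K \<Longrightarrow> b < \<delta> p r"
        using b' by force+
    qed
    let ?W = "{z \<in> topspace (prod_topology X Z). b < (case z of (p, r) \<Rightarrow> \<delta> p r)}"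
    have W: "openin (prod_topology X Z) ?W"
      using \<delta> unfolding continuous_map_upper_lower_semicontinuous_lt by blast
    have "{p} \<times> K \<subseteq> ?W"
      using p bK compactin_subset_topspace[OF K] by auto
    then obtain U V where UV: "openin X U" "openin Z V" "p \<in> U" "K \<subseteq> V" "U \<times> V \<subseteq> ?W"
      using tube_lemma_right[OF W K p] by blast
    show "\<exists>T. openin ?T T \<and> z \<in> T \<and> T \<subseteq> {z \<in> topspace ?T. c < (case z of (p, K) \<Rightarrow> trunc_infdist \<delta> p K)}"
    proof (intro exI[of _ "U \<times> {K. compactin Z K \<and> K \<subseteq> V}"] conjI)
      show "openin ?T (U \<times> {K. compactin Z K \<and> K \<subseteq> V})"
        using UV openin_vietoris_subset[OF UV(2)] by (simp add: openin_prod_Times_iff)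
      show "z \<in> U \<times> {K. compactin Z K \<and> K \<subseteq> V}"
        using UV K by (auto simp: pK)
      show "U \<times> {K. compactin Z K \<and> K \<subseteq> V}
          \<subseteq> {z \<in> topspace ?T. c < (case z of (p, K) \<Rightarrow> trunc_infdist \<delta> p K)}"
      proof (clarsimp simp: topspace_vietoris, intro conjI)
        fix q L assume q: "q \<in> U" and L: "compactin Z L" "L \<subseteq> V"
        show "q \<in> topspace X"
          using q openin_subset[OF UV(1)] by blast
        have "\<not> trunc_infdist \<delta> q L < b"
          using b1 q L(2) UV(5) by (subst trunc_infdist_less_iff) (fastforce simp: nonneg)+
        then show "c < trunc_infdist \<delta> q L"
          using b by simp
      qed
    qed
  qed
qed

text \<open>An infimum is zero when the distances become arbitrarily small, and closedness of the
  set of distances then makes zero one of them.\<close>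

lemma trunc_infdist_eq_0_iff:
  assumes nonneg: "\<And>p r. 0 \<le> \<delta> p r" and closed: "closed (\<delta> p ` K)"
  shows "trunc_infdist \<delta> p K = 0 \<longleftrightarrow> (\<exists>r\<in>K. \<delta> p r = 0)"
proof -
  have "trunc_infdist \<delta> p K = 0 \<longleftrightarrow> (\<forall>c>0. trunc_infdist \<delta> p K < c)"
    using trunc_infdist_nonneg[of K \<delta> p, OF nonneg] by (metis less_irrefl order_le_imp_less_or_eq)
  also have "\<dots> \<longleftrightarrow> (\<forall>c>0. \<exists>r\<in>K. \<delta> p r < c)"
  proof (intro iffI allI impI)
    fix c :: real assume *: "\<forall>c>0. trunc_infdist \<delta> p K < c" and "0 < c"
    \<comment> \<open>The minimum with \<open>1\<close> rules out that the truncation value alone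
      accounts for the bound.\<close>
    then have "trunc_infdist \<delta> p K < min c 1"
      by simp
    then show "\<exists>r\<in>K. \<delta> p r < c"
      by (subst (asm) trunc_infdist_less_iff) (auto simp: nonneg)
  next
    fix c :: real assume "\<forall>c>0. \<exists>r\<in>K. \<delta> p r < c" "0 < c"
    then show "trunc_infdist \<delta> p K < c"
      by (subst trunc_infdist_less_iff) (auto simp: nonneg)
  qed
  also have "\<dots> \<longleftrightarrow> 0 \<in> \<delta> p ` K"
    using closed_approachable[OF closed, of 0] nonneg by (simp add: dist_real_def)
  finally show ?thesis
    by auto
qed

text \<open>With \<open>e\<close> the distance from \<open>p\<close> to \<open>q\<close>, this is
  the 1-Lipschitz estimate for the distance to a fixed set.\<close>

lemma trunc_infdist_le_add:
  assumes nonneg: "\<And>p r. 0 \<le> \<delta> p r" and tri: "\<And>r. r \<in> K \<Longrightarrow> \<delta> p r \<le> e + \<delta> q r" and "0 \<le> e"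
  shows "trunc_infdist \<delta> p K \<le> e + trunc_infdist \<delta> q K"
proof (rule ccontr)
  assume "\<not> ?thesis"
  then have "trunc_infdist \<delta> q K < trunc_infdist \<delta> p K - e"
    by simp
  then have "1 < trunc_infdist \<delta> p K - e \<or> (\<exists>r\<in>K. \<delta> q r < trunc_infdist \<delta> p K - e)"
    by (subst (asm) trunc_infdist_less_iff) (auto simp: nonneg)
  then have "1 < trunc_infdist \<delta> p K \<or> (\<exists>r\<in>K. \<delta> p r < trunc_infdist \<delta> p K)"
    using tri \<open>0 \<le> e\<close> by force
  then have "trunc_infdist \<delta> p K < trunc_infdist \<delta> p K"
    by (subst trunc_infdist_less_iff) (auto simp: nonneg)
  then show False
    by simp
qed

section \<open>Hyperspaces of compact sets are Polish\<close>

lemma continuous_map_dist: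
  "continuous_map (prod_topology (euclidean :: 'a::metric_space topology) (top_of_set S)) euclideanreal
     (\<lambda>(p, r). dist p r)"
proof -
  have "continuous_on (UNIV \<times> S) (\<lambda>z. dist (fst z) (snd z))"
    by (intro continuous_intros)
  then show ?thesis
    using prod_topology_subtopology_eu[of "UNIV :: 'a set" S] by (simp add: case_prod_beta')
qed

text \<open>The map \<open>\<Phi>\<close> sends \<open>K\<close> to its truncated distances from a
  countable dense set. It is a continuous injection of a compact space into a Hausdorff space, hence
  an embedding, and its image is compact and therefore closed in a Polish space.\<close>

lemma polish_topology_vietoris_compact:
  fixes Q :: "'a::polish_space set"
  assumes Q: "compact Q"
  shows "polish_topology (vietoris (top_of_set Q))"
proof -
  obtain D :: "'a set" where D: "countable D" "\<And>X. open X \<Longrightarrow> X \<noteq> {} \<Longrightarrow> \<exists>d\<in>D. d \<in> X"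
    using countable_dense_setE by blast
  have "D \<noteq> {}"
    using D(2)[of UNIV] by auto
  define \<Phi> :: "'a set \<Rightarrow> nat \<Rightarrow> real"
    where "\<Phi> K n = trunc_infdist dist (from_nat_into D n) K" for K n
  have cont: "continuous_map (prod_topology euclidean (vietoris (top_of_set Q))) euclideanreal
      (\<lambda>(p, K). trunc_infdist dist p K)"
    by (rule continuous_map_trunc_infdist[OF continuous_map_dist]) simp
  have "continuous_map (vietoris (top_of_set Q)) euclidean \<Phi>"
    unfolding euclidean_product_topology[symmetric] continuous_map_componentwise_UNIV
  proof
    fix n
    have "continuous_map (vietoris (top_of_set Q)) (prod_topology euclidean (vietoris (top_of_set Q)))
        (\<lambda>K. (from_nat_into D n, K))"
      by (simp add: continuous_map_pairedI)
    from continuous_map_compose[OF this cont]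
    show "continuous_map (vietoris (top_of_set Q)) euclideanreal (\<lambda>K. \<Phi> K n)"
      by (simp add: o_def \<Phi>_def)
  qed
  moreover have "inj_on \<Phi> (topspace (vietoris (top_of_set Q)))"
  proof (rule inj_onI)
    fix K L assume K: "K \<in> topspace (vietoris (top_of_set Q))"
      and L: "L \<in> topspace (vietoris (top_of_set Q))" and eq: "\<Phi> K = \<Phi> L"
    have cont': "continuous_on UNIV (\<lambda>p. trunc_infdist dist p K')"
      if "K' \<in> topspace (vietoris (top_of_set Q))" for K'
    proof -
      have "continuous_map euclidean (prod_topology euclidean (vietoris (top_of_set Q))) (\<lambda>p. (p, K'))"
        using that by (simp add: continuous_map_pairedI)
      from continuous_map_compose[OF this cont] show ?thesis
        by (simp add: o_def)
    qed
    \<comment> \<open>Distance functions that agree on the dense set \<open>D\<close> agree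
      everywhere by continuity, and a compact set is the zero set of its distance function.\<close>
    have "open {p. trunc_infdist dist p K \<noteq> trunc_infdist dist p L}"
      by (intro open_Collect_neq cont' K L)
    moreover have "trunc_infdist dist d K = trunc_infdist dist d L" if "d \<in> D" for d
      using fun_cong[OF eq, of "to_nat_on D d"] D(1) that by (simp add: \<Phi>_def)
    ultimately have "trunc_infdist dist p K = trunc_infdist dist p L" for p
      using D(2)[of "{p. trunc_infdist dist p K \<noteq> trunc_infdist dist p L}"] by auto
    moreover have "trunc_infdist dist p K' = 0 \<longleftrightarrow> p \<in> K'"
      if "K' \<in> topspace (vietoris (top_of_set Q))" for K' p
    proof -
      have "compact (dist p ` K')"
        using that by (intro compact_continuous_image continuous_intros)
          (simp add: topspace_vietoris compactin_subtopology)
      then show ?thesis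
        by (subst trunc_infdist_eq_0_iff) (auto simp: compact_imp_closed)
    qed
    ultimately have "p \<in> K \<longleftrightarrow> p \<in> L" for p
      using K L by metis
    then show "K = L"
      by (rule set_eqI)
  qed
  moreover have "compact_space (vietoris (top_of_set Q))"
    using Q by (simp add: compact_space_vietoris compact_space_subtopology)
  ultimately have emb: "embedding_map (vietoris (top_of_set Q)) euclidean \<Phi>"
    and cpt: "compactin euclidean (\<Phi> ` topspace (vietoris (top_of_set Q)))"
    by (intro continuous_imp_embedding_map image_compactin; simp add: compact_space_def)+
  have "polish_topology (top_of_set (\<Phi> ` topspace (vietoris (top_of_set Q))))"
    using cpt by (intro polish_topology_closedin polish_topology_euclidean) (simp add: compact_imp_closed)
  then show ?thesis
    using homeomorphic_polish_topology[OF embedding_map_imp_homeomorphic_space[OF emb]] by blast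
qed

text \<open>Truncated distances to a countable dense set embed the space in the Hilbert cube. The
  image is again completely metrizable, hence a G-delta in the metrizable cube.\<close>

lemma polish_topology_homeomorphic_gdelta_cube:
  assumes "polish_topology X"
  obtains S :: "(nat \<Rightarrow> real) set"
  where "gdelta_in (top_of_set (PiE UNIV (\<lambda>_. {0..1}))) S"
    and "X homeomorphic_space subtopology (top_of_set (PiE UNIV (\<lambda>_. {0..1}))) S"
proof -
  let ?Q = "top_of_set (PiE UNIV (\<lambda>_. {0..1})) :: (nat \<Rightarrow> real) topology"
  obtain M d where "Metric_space M d" and X: "X = Metric_space.mtopology M d"
    using assms by (auto simp: polish_topology_def completely_metrizable_space_def)
  then interpret Metric_space M d by simp
  have "separable_space X"
    using assms second_countable_imp_separable_space polish_topology_def by blast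
  then obtain C where C: "countable C" "C \<subseteq> M" "X closure_of C = M"
    unfolding separable_space_def X by auto
  define e :: "_ \<Rightarrow> nat \<Rightarrow> real" where "e x n = min 1 (d x (from_nat_into C n))" for x n
  have near: "\<exists>n. from_nat_into C n \<in> M \<and> d x (from_nat_into C n) < \<epsilon>" if "x \<in> M" "0 < \<epsilon>" for x \<epsilon>
  proof -
    have "x \<in> mtopology closure_of C"
      using C(3) that(1) unfolding X by simp
    then obtain y where "y \<in> C" "y \<in> M" "d x y < \<epsilon>"
      using \<open>0 < \<epsilon>\<close> by (auto simp: metric_closure_of)
    then show ?thesis
      using C(1) by (metis from_nat_into_to_nat_on)
  qed
  have inM: "from_nat_into C n \<in> M" if "x \<in> M" for x n
  proof -
    have "C \<noteq> {}"
      using C(3) that by auto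
    then show ?thesis
      by (rule subsetD[OF C(2) from_nat_into])
  qed
  have sub: "e ` M \<subseteq> PiE UNIV (\<lambda>_. {0..1})"
    by (auto simp: e_def)
  have "continuous_map X ?Q e"
  proof (rule continuous_map_into_subtopology)
    have "continuous_map X euclideanreal (\<lambda>x. e x n)" for n
    \<comment> \<open>For empty \<open>M\<close> the enumeration of \<open>C\<close> takes an
      arbitrary value outside \<open>M\<close>, so the metric axioms say nothing about it.\<close>
    proof (cases "M = {}")
      case True
      then have "X = trivial_topology"
        using X topspace_mtopology null_topspace_iff_trivial by metis
      then show ?thesis
        by simp
    next
      case False
      define s where "s = from_nat_into C n"
      have s: "s \<in> M"
        using False inM by (auto simp: s_def)
      have "{x \<in> topspace X. d x s < c} = mball s c" "{x \<in> topspace X. c < d x s} = topspace X - mcball s c" for c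
        using s by (auto simp: X commute)
      then have "continuous_map X euclideanreal (\<lambda>x. d x s)"
        unfolding continuous_map_upper_lower_semicontinuous_lt by (simp add: X openin_diff)
      then show ?thesis
        unfolding e_def s_def by (intro continuous_map_real_min) simp_all
    qed
    then show "continuous_map X euclidean e"
      unfolding euclidean_product_topology[symmetric] continuous_map_componentwise_UNIV by blast
  qed (use sub in \<open>auto simp: X\<close>)
  then have 1: "continuous_map X (subtopology ?Q (e ` topspace X)) e"
    by (rule continuous_map_into_subtopology) blast
  \<comment> \<open>Below \<open>1\<close> the truncation is inactive, so two points that are both
    close to the same member of \<open>C\<close> are close to each other. Injectivity and openness
    of \<open>e\<close> both rest on this.\<close>
  have small: "d x y < 2 * \<epsilon>"
    if "x \<in> M" "y \<in> M" "from_nat_into C n \<in> M" "\<epsilon> \<le> 1" "e x n < \<epsilon>" "e y n < \<epsilon>" for x y n \<epsilon>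
  proof -
    have "d x (from_nat_into C n) < \<epsilon>" "d y (from_nat_into C n) < \<epsilon>"
      using that by (auto simp: e_def)
    then show ?thesis
      using triangle[of x "from_nat_into C n" y] that commute[of y] by simp
  qed
  have 2: "inj_on e (topspace X)"
  proof (rule inj_onI)
    fix x y assume xy: "x \<in> topspace X" "y \<in> topspace X" "e x = e y"
    then have M: "x \<in> M" "y \<in> M"
      by (simp_all add: X)
    show "x = y"
    proof (rule ccontr)
      assume "x \<noteq> y"
      then have "0 < min 1 (d x y / 2)"
        using M by simp
      then obtain n where n: "from_nat_into C n \<in> M" "d x (from_nat_into C n) < min 1 (d x y / 2)"
        using near[OF M(1)] by blast
      then have "e x n < min 1 (d x y / 2)"
        by (simp add: e_def)
      then show False
        using small[OF M n(1), of "min 1 (d x y / 2)"] xy(3) by simp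
    qed
  qed
  have 3: "open_map X (subtopology ?Q (e ` topspace X)) e"
    unfolding open_map_def
  proof (intro allI impI)
    fix W assume W: "openin X W"
    show "openin (subtopology ?Q (e ` topspace X)) (e ` W)"
    proof (subst openin_subopen, intro ballI)
      fix z assume "z \<in> e ` W"
      then obtain x where x: "x \<in> W" "z = e x"
        by blast
      then obtain r where r: "r > 0" "mball x r \<subseteq> W" "x \<in> M"
        using W unfolding X openin_mtopology by (metis subsetD)
      define \<epsilon> where "\<epsilon> = min 1 (r / 2)"
      have "0 < \<epsilon>" "\<epsilon> \<le> 1" "2 * \<epsilon> \<le> r"
        using r by (auto simp: \<epsilon>_def)
      then obtain n where n: "from_nat_into C n \<in> M" "d x (from_nat_into C n) < \<epsilon>"
        using near[OF r(3)] by blast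
      then have exn: "e x n < \<epsilon>"
        by (simp add: e_def)
      \<comment> \<open>One coordinate suffices: a point of the image with small \<open>n\<close>-th
        coordinate comes from a point close to \<open>x\<close>, since both are near the
        \<open>n\<close>-th member of \<open>C\<close>.\<close>
      let ?O = "{f \<in> topspace (subtopology ?Q (e ` topspace X)). f n < \<epsilon>}"
      have "open {f :: nat \<Rightarrow> real. f n < \<epsilon>}"
        by (intro open_Collect_less continuous_intros continuous_on_product_coordinates)
      moreover have "?O = {f. f n < \<epsilon>} \<inter> topspace (subtopology ?Q (e ` topspace X))"
        by auto
      ultimately have "openin (subtopology ?Q (e ` topspace X)) ?O"
        by (simp add: subtopology_subtopology openin_open Int_commute) blast
      moreover have "z \<in> ?O"
        using x exn r(3) sub by (auto simp: X)
      moreover have "?O \<subseteq> e ` W"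
      proof
        fix f assume "f \<in> ?O"
        then obtain y where y: "y \<in> M" "f = e y" "e y n < \<epsilon>"
          by (auto simp: X)
        then have "d x y < r"
          using small[OF r(3) y(1) n(1) \<open>\<epsilon> \<le> 1\<close> exn y(3)] \<open>2 * \<epsilon> \<le> r\<close> by simp
        then show "f \<in> e ` W"
          using r y by auto
      qed
      ultimately show "\<exists>T. openin (subtopology ?Q (e ` topspace X)) T \<and> z \<in> T \<and> T \<subseteq> e ` W"
        by blast
    qed
  qed
  have "e ` topspace X = topspace (subtopology ?Q (e ` topspace X))"
    using sub by (auto simp: X)
  then have "embedding_map X ?Q e"
    unfolding embedding_map_def using 1 2 3 bijective_open_imp_homeomorphic_map by blast
  then have hom: "X homeomorphic_space subtopology ?Q (e ` topspace X)"
    by (rule embedding_map_imp_homeomorphic_space)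
  moreover have "gdelta_in ?Q (e ` topspace X)"
  proof -
    have "completely_metrizable_space (subtopology ?Q (e ` topspace X))"
      using hom homeomorphic_polish_topology assms polish_topology_def by blast
    moreover have "e ` topspace X \<subseteq> topspace ?Q"
      using sub X by simp
    ultimately show ?thesis
      by (intro completely_metrizable_space_imp_gdelta_in metrizable_space_subtopology metrizable_space_euclidean)
  qed
  ultimately show ?thesis
    using that by blast
qed

text \<open>A set lies in an intersection of open sets exactly when it lies in each of them. The
  compact subsets of a G-delta therefore form a G-delta in the hyperspace of the cube.\<close>

lemma polish_topology_vietoris:
  assumes "polish_topology X"
  shows "polish_topology (vietoris X)"
proof -
  let ?Q = "top_of_set (PiE UNIV (\<lambda>_. {0..1})) :: (nat \<Rightarrow> real) topology"
  obtain S where S: "gdelta_in ?Q S" "X homeomorphic_space subtopology ?Q S"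
    using polish_topology_homeomorphic_gdelta_cube[OF assms] by blast
  obtain \<U> where \<U>: "countable \<U>" "\<And>U. U \<in> \<U> \<Longrightarrow> openin ?Q U" "S = \<Inter>\<U>"
    using S(1) unfolding gdelta_in_alt intersection_of_def by (auto simp: subset_iff)
  have "compact (PiE UNIV (\<lambda>_. {0..1}) :: (nat \<Rightarrow> real) set)"
    using compactin_PiE[of "\<lambda>_. euclideanreal" UNIV "\<lambda>_. {0..1}"] by (simp add: euclidean_product_topology)
  then have Q: "polish_topology (vietoris ?Q)"
    by (rule polish_topology_vietoris_compact)
  \<comment> \<open>The intersection with the whole hyperspace gives the right value also for
    \<open>\<U> = {}\<close>.\<close>
  have "gdelta_in (vietoris ?Q) ((\<Inter>U\<in>\<U>. {K. compactin ?Q K \<and> K \<subseteq> U}) \<inter> topspace (vietoris ?Q))"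
  proof (cases "\<U> = {}")
    case False
    have "gdelta_in (vietoris ?Q) (\<Inter>U\<in>\<U>. {K. compactin ?Q K \<and> K \<subseteq> U})"
      using False \<U>(1,2) openin_vietoris_subset by (intro gdelta_in_Inter) (auto intro!: open_imp_gdelta_in)
    then show ?thesis
      by (simp add: gdelta_in_Int)
  qed simp
  also have "(\<Inter>U\<in>\<U>. {K. compactin ?Q K \<and> K \<subseteq> U}) \<inter> topspace (vietoris ?Q)
      = {K \<in> topspace (vietoris ?Q). K \<subseteq> S}"
    by (auto simp: \<U>(3) topspace_vietoris)
  finally have "polish_topology (subtopology (vietoris ?Q) {K \<in> topspace (vietoris ?Q). K \<subseteq> S})"
    using polish_topology_gdelta Q by blast
  then have "polish_topology (subtopology (vietoris ?Q) {K. K \<subseteq> S})"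
    using subtopology_restrict[of "vietoris ?Q" "{K. K \<subseteq> S}"] by (simp add: Int_def)
  then show ?thesis
    using vietoris_subtopology homeomorphic_space_vietoris[OF S(2)] homeomorphic_polish_topology by metis
qed

section \<open>The standard Borel space of structures\<close>

lemma polish_topology_power_topology:
  "polish_topology (power_topology (euclidean :: 'a::polish_space topology) k)"
  by (intro polish_topology_product_topology polish_topology_euclidean) simp

text \<open>The power of \<open>M\<close> is compact and Hausdorff, so its closed subsets are its
  compact ones, and compactness can be tested in the ambient power.\<close>

lemma closedin_power_topology_top_of_set_iff:
  fixes M :: "'a::metric_space set"
  assumes "compact M"
  shows "closedin (power_topology (top_of_set M) k) S \<longleftrightarrow>
    compactin (power_topology euclidean k) S \<and> S \<subseteq> PiE {1..k} (\<lambda>_. M)"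
proof -
  have eq: "power_topology (top_of_set M) k
      = subtopology (power_topology euclidean k) (PiE {1..k} (\<lambda>_. M))"
    by (simp add: subtopology_product_topology)
  have comp: "compact_space (power_topology (top_of_set M) k)"
    using assms by (simp add: compact_space_product_topology compact_space_subtopology)
  have "Hausdorff_space (power_topology (top_of_set M) k)"
    by (simp add: Hausdorff_space_product_topology Hausdorff_space_subtopology)
  then have "closedin (power_topology (top_of_set M) k) S \<longleftrightarrow> compactin (power_topology (top_of_set M) k) S"
    using comp closedin_compact_space compactin_imp_closedin by blast
  then show ?thesis
    unfolding eq compactin_subtopology .
qed

lemma compactin_power_topology_relation:
  assumes "(M, R) \<in> compact_structures" and "1 \<le> k"
  shows "compactin (power_topology euclidean k) (R k)"
  using assms closedin_power_topology_top_of_set_iff unfolding compact_structures_def by blast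

lemma relation_subset_PiE:
  assumes "(M, R) \<in> compact_structures" and "1 \<le> k"
  shows "R k \<subseteq> PiE {1..k} (\<lambda>_. M)"
  using assms closedin_power_topology_top_of_set_iff unfolding compact_structures_def by blast

text \<open>The codes are closed in a product of Polish hyperspaces. A tuple in \<open>R k\<close>
  with an entry outside \<open>M\<close> witnesses failure, and the failure persists once open sets
  separate that entry from \<open>M\<close>.\<close>

lemma polish_topology_structure_topology:
  "polish_topology (structure_topology :: 'u::polish_space structure_code topology)"
proof -
  let ?P = "prod_topology (vietoris euclidean)
    (product_topology (\<lambda>k. vietoris (power_topology euclidean k)) {1..}) :: 'u structure_code topology"
  have P: "polish_topology ?P"
    by (intro polish_topology_prod_topology polish_topology_product_topology polish_topology_vietoris
        polish_topology_power_topology polish_topology_euclidean) simp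
  have sub: "compact_structures \<subseteq> topspace ?P"
    using topspace_structure_topology unfolding structure_topology_def topspace_subtopology by blast
  have "openin ?P (topspace ?P - compact_structures)"
  proof (subst openin_subopen, intro ballI)
    fix z assume z: "z \<in> topspace ?P - compact_structures"
    obtain M R where MR: "z = (M, R)"
      by fastforce
    have M: "compact M" and Rext: "R \<in> extensional {1..}"
      and R: "\<And>k. 1 \<le> k \<Longrightarrow> compactin (power_topology euclidean k) (R k)"
      using z by (auto simp: MR topspace_vietoris PiE_iff simp del: topspace_product_topology_alt)
    \<comment> \<open>In the ambient product, compactness of \<open>M\<close> and of the relations
      and extensionality hold already, so only \<open>R k \<subseteq> M^k\<close> can fail.\<close>
    obtain k where k: "1 \<le> k" "\<not> R k \<subseteq> PiE {1..k} (\<lambda>_. M)"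
      using z M Rext R closedin_power_topology_top_of_set_iff[OF M]
      unfolding MR compact_structures_def by blast
    then obtain r where r: "r \<in> R k" "r \<notin> PiE {1..k} (\<lambda>_. M)"
      by blast
    have "r \<in> extensional {1..k}"
      using compactin_subset_topspace[OF R[OF k(1)]] r(1) by (auto simp: PiE_iff)
    with r(2) obtain i where i: "i \<in> {1..k}" "r i \<notin> M"
      by (auto simp: PiE_iff)
    obtain U V where UV: "open U" "open V" "r i \<in> U" "M \<subseteq> V" "U \<inter> V = {}"
    proof -
      have "open (- M)"
        using M by (simp add: compact_imp_closed open_Compl)
      then obtain e where "e > 0" "ball (r i) e \<subseteq> - M"
        using i(2) open_contains_ball by blast
      \<comment> \<open>Halving the radius keeps \<open>M\<close> away from the closed ball, whose
        complement then serves as \<open>V\<close>.\<close>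
      then show ?thesis
        by (intro that[of "ball (r i) (e/2)" "- cball (r i) (e/2)"]) force+
    qed
    let ?U = "{r \<in> topspace (power_topology euclidean k). r i \<in> U}"
    let ?A = "{K. compactin euclidean K \<and> K \<subseteq> V}"
    let ?B = "{S \<in> topspace (product_topology (\<lambda>k. vietoris (power_topology (euclidean :: 'u topology) k)) {1..}).
      S k \<in> {K. compactin (power_topology euclidean k) K \<and> K \<inter> ?U \<noteq> {}}}"
    have U: "openin (power_topology euclidean k) ?U"
      using i(1) UV(1) by (intro openin_product_topology_coordinate) simp_all
    have "openin (product_topology (\<lambda>k. vietoris (power_topology (euclidean :: 'u topology) k)) {1..}) ?B"
      using k(1) openin_vietoris_meets[OF U] by (intro openin_product_topology_coordinate) auto
    moreover have "openin (vietoris euclidean) ?A"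
      using UV(2) by (intro openin_vietoris_subset) simp
    ultimately have "openin ?P (?A \<times> ?B)"
      by (simp add: openin_prod_Times_iff del: topspace_product_topology)
    moreover have "z \<in> ?A \<times> ?B"
    proof -
      have "r \<in> ?U"
        using compactin_subset_topspace[OF R[OF k(1)]] r(1) UV(3) by blast
      then have "R k \<inter> ?U \<noteq> {}"
        using r(1) by blast
      then show ?thesis
        using z R[OF k(1)] M UV(4) unfolding MR by simp
    qed
    moreover have "?A \<times> ?B \<subseteq> topspace ?P - compact_structures"
    proof (rule subsetI, rule DiffI)
      fix w assume w: "w \<in> ?A \<times> ?B"
      with \<open>openin ?P (?A \<times> ?B)\<close> show "w \<in> topspace ?P"
        using openin_subset by blast
      obtain N S where NS: "w = (N, S)"
        by fastforce
      obtain s where s: "s \<in> S k" "s i \<in> U"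
        using w unfolding NS by blast
      moreover have "N \<subseteq> V"
        using w unfolding NS by blast
      ultimately have "s i \<notin> N"
        using UV(5) by blast
      then show "w \<notin> compact_structures"
        using relation_subset_PiE[OF _ k(1), of N S] s(1) i(1) unfolding NS by (blast dest: PiE_mem)
    qed
    ultimately show "\<exists>T. openin ?P T \<and> z \<in> T \<and> T \<subseteq> topspace ?P - compact_structures"
      by blast
  qed
  then have "closedin ?P compact_structures"
    using sub by (simp add: closedin_def)
  then show ?thesis
    unfolding structure_topology_def using P polish_topology_closedin by blast
qed

section \<open>Borel sets of a topology\<close>

lemma space_borel_of: "space (borel_of T) = topspace T"
  unfolding borel_of_def by (rule space_measure_of) (auto dest: openin_subset)

lemma sets_borel_of: "openin T U \<Longrightarrow> U \<in> sets (borel_of T)"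
  unfolding borel_of_def by (subst sets_measure_of) (auto dest: openin_subset)

lemma borel_of_euclidean: "borel_of euclidean = borel"
  by (simp add: borel_of_def borel_def)


section \<open>Isometric isomorphism\<close>

text \<open>A point \<open>z\<close> outside the closed image has some distance \<open>e\<close>
  from it. All iterates of \<open>z\<close> are then at least \<open>e\<close> apart, so no
  subsequence of them is Cauchy, against compactness.\<close>

lemma isometric_self_embedding_onto:
  fixes g :: "'a::metric_space \<Rightarrow> 'a"
  assumes M: "compact M" and gM: "g ` M \<subseteq> M"
    and iso: "\<And>x y. x \<in> M \<Longrightarrow> y \<in> M \<Longrightarrow> dist (g x) (g y) = dist x y"
  shows "g ` M = M"
proof (rule ccontr)
  assume "g ` M \<noteq> M"
  then obtain z where z: "z \<in> M" "z \<notin> g ` M"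
    using gM by blast
  have "continuous_on M g"
    unfolding continuous_on_iff using iso by metis
  then have "closed (g ` M)"
    using M compact_continuous_image compact_imp_closed by blast
  then obtain e where e: "e > 0" "\<And>y. y \<in> M \<Longrightarrow> e \<le> dist (g y) z"
    using z(2) closed_approachable[of "g ` M" z] by (metis imageI not_le)
  have inM: "(g ^^ n) y \<in> M" if "y \<in> M" for n y
    using that gM by (induction n) auto
  have isoN: "dist ((g ^^ n) x) ((g ^^ n) y) = dist x y" if "x \<in> M" "y \<in> M" for n x y
    by (induction n) (use that inM iso in auto)
  have far: "e \<le> dist ((g ^^ n) z) ((g ^^ m) z)" if "m < n" for m n
  proof -
    \<comment> \<open>Cancelling the isometry \<open>g ^^ m\<close> leaves \<open>z\<close> and a
      later iterate. The exponent \<open>Suc j\<close> is positive, so that iterate lies in the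
      image of \<open>g\<close>.\<close>
    obtain j where "n = m + Suc j"
      using \<open>m < n\<close> by (auto simp: less_iff_Suc_add)
    then have "(g ^^ n) z = (g ^^ m) ((g ^^ Suc j) z)"
      by (simp only: funpow_add o_apply)
    then have "dist ((g ^^ n) z) ((g ^^ m) z) = dist ((g ^^ Suc j) z) z"
      using isoN[OF inM[OF z(1)] z(1)] by (simp only:)
    then show ?thesis
      using e(2)[OF inM[OF z(1), of j]] by simp
  qed
  have "seq_compact M"
    using M by (simp add: compact_eq_seq_compact_metric)
  moreover have "\<forall>n. (g ^^ n) z \<in> M"
    using inM[OF z(1)] by simp
  ultimately obtain l s where s: "strict_mono s" "((\<lambda>n. (g ^^ n) z) \<circ> s) \<longlonglongrightarrow> l"
    by (rule seq_compactE)
  then have "(\<lambda>n. (g ^^ s n) z) \<longlonglongrightarrow> l"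
    by (simp add: o_def)
  then have "Cauchy (\<lambda>n. (g ^^ s n) z)"
    using LIMSEQ_imp_Cauchy by blast
  then obtain N where "\<And>m n. m \<ge> N \<Longrightarrow> n \<ge> N \<Longrightarrow> dist ((g ^^ s m) z) ((g ^^ s n) z) < e"
    using e(1) unfolding Cauchy_def by blast
  then have "dist ((g ^^ s (Suc N)) z) ((g ^^ s N) z) < e"
    by simp
  then show False
    using far[of "s N" "s (Suc N)"] s(1) by (simp add: strict_mono_Suc_iff)
qed

lemma isometric_isomorphism_refl:
  assumes "A \<in> compact_structures"
  shows "isometric_isomorphism A A (\<lambda>x. x)"
proof -
  have "(\<lambda>i\<in>{1..k}. x i) = x" if "x \<in> {1..k} \<rightarrow>\<^sub>E M" for x :: "nat \<Rightarrow> 'a" and k M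
    using PiE_restrict[OF that] by simp
  then show ?thesis
    by (cases A) (auto simp: isometric_isomorphism_def bij_betw_def)
qed

lemma isometric_isomorphism_sym:
  assumes "isometric_isomorphism A B \<phi>"
  shows "isometric_isomorphism B A (inv_into (fst A) \<phi>)"
proof -
  obtain M R N S where AB: "A = (M, R)" "B = (N, S)"
    by fastforce
  have bij: "bij_betw \<phi> M N" and iso: "\<And>x y. x \<in> M \<Longrightarrow> y \<in> M \<Longrightarrow> dist (\<phi> x) (\<phi> y) = dist x y"
    and rel: "\<And>k x. 1 \<le> k \<Longrightarrow> x \<in> {1..k} \<rightarrow>\<^sub>E M \<Longrightarrow> x \<in> R k \<longleftrightarrow> (\<lambda>i\<in>{1..k}. \<phi> (x i)) \<in> S k"
    using assms unfolding AB isometric_isomorphism_def by auto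
  let ?\<psi> = "inv_into M \<phi>"
  have \<psi>: "?\<psi> y \<in> M" "\<phi> (?\<psi> y) = y" if "y \<in> N" for y
    using bij that bij_betw_inv_into bij_betwE bij_betw_inv_into_right by metis+
  have "y \<in> S k \<longleftrightarrow> (\<lambda>i\<in>{1..k}. ?\<psi> (y i)) \<in> R k" if "1 \<le> k" "y \<in> {1..k} \<rightarrow>\<^sub>E N" for k y
  proof -
    have "(\<lambda>i\<in>{1..k}. ?\<psi> (y i)) \<in> {1..k} \<rightarrow>\<^sub>E M"
      using that(2) \<psi> by (auto simp: PiE_iff)
    then have "(\<lambda>i\<in>{1..k}. ?\<psi> (y i)) \<in> R k \<longleftrightarrow> (\<lambda>i\<in>{1..k}. \<phi> ((\<lambda>i\<in>{1..k}. ?\<psi> (y i)) i)) \<in> S k"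
      by (rule rel[OF that(1)])
    also have "(\<lambda>i\<in>{1..k}. \<phi> ((\<lambda>i\<in>{1..k}. ?\<psi> (y i)) i)) = y"
      using that(2) \<psi> by (auto simp: fun_eq_iff PiE_iff extensional_def)
    finally show ?thesis
      by (rule sym)
  qed
  moreover have "dist (?\<psi> x) (?\<psi> y) = dist x y" if "x \<in> N" "y \<in> N" for x y
    using iso \<psi> that by metis
  ultimately show ?thesis
    unfolding AB isometric_isomorphism_def using bij_betw_inv_into[OF bij] by simp
qed

lemma isometric_isomorphism_trans:
  assumes "isometric_isomorphism A B \<phi>" and "isometric_isomorphism B C \<psi>"
  shows "isometric_isomorphism A C (\<lambda>x. \<psi> (\<phi> x))"
proof -
  obtain M R N S L T where ABC: "A = (M, R)" "B = (N, S)" "C = (L, T)"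
    by (metis surj_pair)
  have 1: "bij_betw \<phi> M N" "\<And>x y. x \<in> M \<Longrightarrow> y \<in> M \<Longrightarrow> dist (\<phi> x) (\<phi> y) = dist x y"
    "\<And>k x. 1 \<le> k \<Longrightarrow> x \<in> {1..k} \<rightarrow>\<^sub>E M \<Longrightarrow> x \<in> R k \<longleftrightarrow> (\<lambda>i\<in>{1..k}. \<phi> (x i)) \<in> S k"
    using assms(1) unfolding ABC isometric_isomorphism_def by auto
  have 2: "bij_betw \<psi> N L" "\<And>x y. x \<in> N \<Longrightarrow> y \<in> N \<Longrightarrow> dist (\<psi> x) (\<psi> y) = dist x y"
    "\<And>k x. 1 \<le> k \<Longrightarrow> x \<in> {1..k} \<rightarrow>\<^sub>E N \<Longrightarrow> x \<in> S k \<longleftrightarrow> (\<lambda>i\<in>{1..k}. \<psi> (x i)) \<in> T k"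
    using assms(2) unfolding ABC isometric_isomorphism_def by auto
  have \<phi>: "\<phi> x \<in> N" if "x \<in> M" for x
    using 1(1) that bij_betwE by blast
  have "x \<in> R k \<longleftrightarrow> (\<lambda>i\<in>{1..k}. \<psi> (\<phi> (x i))) \<in> T k" if "1 \<le> k" "x \<in> {1..k} \<rightarrow>\<^sub>E M" for k x
  proof -
    have "(\<lambda>i\<in>{1..k}. \<phi> (x i)) \<in> {1..k} \<rightarrow>\<^sub>E N"
      using that(2) \<phi> by (auto simp: PiE_iff)
    moreover have "(\<lambda>i\<in>{1..k}. \<psi> ((\<lambda>i\<in>{1..k}. \<phi> (x i)) i)) = (\<lambda>i\<in>{1..k}. \<psi> (\<phi> (x i)))"
      by auto
    ultimately show ?thesis
      using 1(3)[OF that] 2(3)[OF that(1)] by metis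
  qed
  moreover have "bij_betw (\<lambda>x. \<psi> (\<phi> x)) M L"
    using bij_betw_trans[OF 1(1) 2(1)] by (simp add: o_def)
  ultimately show ?thesis
    unfolding ABC isometric_isomorphism_def using 1(2) 2(2) \<phi> by simp
qed

lemma equiv_isometric_isomorphism_relation:
  "equiv compact_structures isometric_isomorphism_relation"
proof (rule equivI)
  show "refl_on compact_structures isometric_isomorphism_relation"
    using isometric_isomorphism_refl by (auto simp: refl_on_def isometric_isomorphism_relation_def)
  show "sym isometric_isomorphism_relation"
    unfolding sym_def isometric_isomorphism_relation_def
    by clarsimp (metis isometric_isomorphism_sym)
  show "trans isometric_isomorphism_relation"
    using isometric_isomorphism_trans unfolding trans_def isometric_isomorphism_relation_def by blast
qed (auto simp: isometric_isomorphism_relation_def)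

section \<open>Profiles of sequences in a structure\<close>

text \<open>The sum metric on the \<open>k\<close>-th power. Since only the coordinates
  \<open>1..k\<close> count, it separates points only among extensional functions.\<close>

definition sum_dist :: "nat \<Rightarrow> (nat \<Rightarrow> 'a::metric_space) \<Rightarrow> (nat \<Rightarrow> 'a) \<Rightarrow> real" where
  "sum_dist k p q = (\<Sum>i\<in>{1..k}. dist (p i) (q i))"

text \<open>Points of the power \<open>M\<^sup>k\<close> are indexed from \<open>1\<close>, list entries from \<open>0\<close>.\<close>

definition subtuple :: "(nat \<Rightarrow> 'a) \<Rightarrow> nat list \<Rightarrow> nat \<Rightarrow> 'a" where
  "subtuple x l = (\<lambda>i\<in>{1..length l}. x (l ! (i - 1)))"

text \<open>Lists of indices of every length handle all arities at once. There is no relation of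
  arity zero, so the empty list gets the dummy value \<open>0\<close>.\<close>

definition profile ::
    "'u::metric_space structure_code \<Rightarrow> (nat \<Rightarrow> 'u) \<Rightarrow> (nat \<times> nat \<Rightarrow> real) \<times> (nat list \<Rightarrow> real)" where
  "profile A x =
     (\<lambda>(i, j). dist (x i) (x j),
      \<lambda>l. if l = [] then 0 else trunc_infdist (sum_dist (length l)) (subtuple x l) (snd A (length l)))"

definition profiles ::
    "'u::metric_space structure_code \<Rightarrow> ((nat \<times> nat \<Rightarrow> real) \<times> (nat list \<Rightarrow> real)) set" where
  "profiles A = profile A ` {x. range x \<subseteq> fst A}"

lemma sum_dist_nonneg: "0 \<le> sum_dist k p q"
  by (simp add: sum_dist_def sum_nonneg)

lemma sum_dist_commute: "sum_dist k p q = sum_dist k q p"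
  by (simp add: sum_dist_def dist_commute)

lemma sum_dist_triangle: "sum_dist k p r \<le> sum_dist k p q + sum_dist k q r"
  unfolding sum_dist_def sum.distrib[symmetric] by (intro sum_mono dist_triangle)

lemma sum_dist_eq_0_iff:
  assumes "p \<in> extensional {1..k}" and "q \<in> extensional {1..k}"
  shows "sum_dist k p q = 0 \<longleftrightarrow> p = q"
proof
  assume "sum_dist k p q = 0"
  then have "p i = q i" if "i \<in> {1..k}" for i
    using that unfolding sum_dist_def by (subst (asm) sum_nonneg_eq_0_iff) auto
  then show "p = q"
    using assms extensionalityI by blast
qed (simp add: sum_dist_def)

section \<open>Continuity of profiles\<close>

lemma continuous_map_dist_comp:
  fixes f g :: "'z \<Rightarrow> 'a::metric_space"
  assumes "continuous_map T euclidean f" and "continuous_map T euclidean g"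
  shows "continuous_map T euclideanreal (\<lambda>z. dist (f z) (g z))"
proof -
  have 1: "continuous_map T euclidean (\<lambda>z. (f z, g z))"
    using continuous_map_pairedI[OF assms] by simp
  have 2: "continuous_map euclidean euclideanreal (\<lambda>z :: 'a \<times> 'a. dist (fst z) (snd z))"
    by (simp, intro continuous_intros)
  from continuous_map_compose[OF 1 2] show ?thesis
    by (simp add: o_def)
qed

lemma continuous_map_sum_dist:
  "continuous_map (prod_topology (power_topology euclidean k) (power_topology euclidean k)) euclideanreal
     (\<lambda>(p, r). sum_dist k p r)"
  unfolding sum_dist_def case_prod_beta'
proof (rule continuous_map_sum)
  fix i assume i: "i \<in> {1..k}"
  let ?P = "power_topology (euclidean :: 'a topology) k"
  have proj: "continuous_map ?P euclidean (\<lambda>x. x i)"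
    using continuous_map_product_projection[OF i, of "\<lambda>_. euclidean"] .
  show "continuous_map (prod_topology ?P ?P) euclideanreal (\<lambda>z. dist (fst z i) (snd z i))"
    using continuous_map_compose[OF continuous_map_fst proj, of ?P]
      continuous_map_compose[OF continuous_map_snd proj, of ?P]
    by (intro continuous_map_dist_comp) (simp_all add: o_def)
qed simp

text \<open>Every coordinate is a distance between entries or a truncated distance, and the latter
  is jointly continuous in the tuple and in the relation as a point of the hyperspace.\<close>

lemma continuous_map_profile:
  "continuous_map (prod_topology euclidean structure_topology) euclidean
     (\<lambda>(x :: nat \<Rightarrow> 'u::metric_space, A). profile A x)"
proof -
  let ?T = "prod_topology (euclidean :: (nat \<Rightarrow> 'u) topology) structure_topology"
  have coord: "continuous_map ?T euclidean (\<lambda>z. fst z n)" for n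
  proof -
    have "continuous_map (euclidean :: (nat \<Rightarrow> 'u) topology) euclidean (\<lambda>x. x n)"
      by (simp add: continuous_on_product_coordinates)
    from continuous_map_compose[OF continuous_map_fst this] show ?thesis
      by (simp add: o_def)
  qed
  have 1: "continuous_map ?T euclideanreal (\<lambda>z. dist (fst z i) (fst z j))" for i j
    by (intro continuous_map_dist_comp coord)
  have 2: "continuous_map ?T euclideanreal
      (\<lambda>z. trunc_infdist (sum_dist (length l)) (subtuple (fst z) l) (snd (snd z) (length l)))"
    if "l \<noteq> []" for l
  proof -
    let ?P = "power_topology (euclidean :: 'u topology) (length l)"
    have l: "length l \<in> {1..}"
      using that by (simp add: Suc_leI)
    have "continuous_map ?T ?P (\<lambda>z. subtuple (fst z) l)"
      unfolding continuous_map_componentwise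
    proof (intro conjI ballI)
      fix i assume "i \<in> {1..length l}"
      then show "continuous_map ?T euclidean (\<lambda>z. subtuple (fst z) l i)"
        using coord[of "l ! (i - 1)"] by (simp add: subtuple_def)
    qed (auto simp: subtuple_def)
    moreover have "continuous_map ?T (vietoris ?P) (\<lambda>z. snd (snd z) (length l))"
    proof -
      have "continuous_map (structure_topology :: 'u structure_code topology)
          (product_topology (\<lambda>k. vietoris (power_topology euclidean k)) {1..}) snd"
        unfolding structure_topology_def
        by (intro continuous_map_from_subtopology continuous_map_snd)
      from continuous_map_compose[OF continuous_map_compose[OF continuous_map_snd this]
          continuous_map_product_projection[OF l]]
      show ?thesis
        by (simp add: o_def)
    qed
    ultimately have "continuous_map ?T (prod_topology ?P (vietoris ?P))
        (\<lambda>z. (subtuple (fst z) l, snd (snd z) (length l)))"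
      by (rule continuous_map_pairedI)
    from continuous_map_compose[OF this continuous_map_trunc_infdist[OF continuous_map_sum_dist sum_dist_nonneg]]
    show ?thesis
      by (simp add: o_def)
  qed
  have "continuous_map ?T euclidean (\<lambda>z. fst (profile (snd z) (fst z)))"
    unfolding euclidean_product_topology[where 'b = real, symmetric] continuous_map_componentwise_UNIV
    using 1 by (auto simp: profile_def)
  moreover have "continuous_map ?T euclidean (\<lambda>z. snd (profile (snd z) (fst z)))"
    unfolding euclidean_product_topology[where 'b = real, symmetric] continuous_map_componentwise_UNIV
  proof
    fix l
    show "continuous_map ?T euclideanreal (\<lambda>z. snd (profile (snd z) (fst z)) l)"
      using 2[of l] by (cases "l = []") (auto simp: profile_def)
  qed
  ultimately have "continuous_map ?T (prod_topology euclidean euclidean)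
      (\<lambda>z. (fst (profile (snd z) (fst z)), snd (profile (snd z) (fst z))))"
    by (rule continuous_map_pairedI)
  then show ?thesis
    by (simp add: case_prod_beta')
qed

text \<open>A basic neighbourhood of a sequence restricts finitely many entries. For nearby
  parameters, lower semicontinuity supplies points for these entries, and any point of the set fills
  the others.\<close>

lemma openin_exists_sequence:
  fixes \<mu> :: "'z \<Rightarrow> 'u::topological_space set"
  assumes lsc: "\<And>U. open U \<Longrightarrow> openin Z {z \<in> topspace Z. \<mu> z \<inter> U \<noteq> {}}"
    and W: "openin (prod_topology (euclidean :: (nat \<Rightarrow> 'u) topology) Z) W"
  shows "openin Z {z \<in> topspace Z. \<exists>x. range x \<subseteq> \<mu> z \<and> (x, z) \<in> W}"
proof (subst openin_subopen, intro ballI)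
  fix z assume "z \<in> {z \<in> topspace Z. \<exists>x. range x \<subseteq> \<mu> z \<and> (x, z) \<in> W}"
  then obtain x where z: "z \<in> topspace Z" and x: "range x \<subseteq> \<mu> z" "(x, z) \<in> W"
    by blast
  obtain A B where AB: "openin (euclidean :: (nat \<Rightarrow> 'u) topology) A" "openin Z B" "x \<in> A" "z \<in> B" "A \<times> B \<subseteq> W"
    using W x(2) unfolding openin_prod_topology_alt by meson
  from AB(1) have "openin (product_topology (\<lambda>_. euclidean) UNIV) A"
    unfolding euclidean_product_topology .
  then obtain U where U: "finite {i. U i \<noteq> UNIV}" "\<And>i. open (U i)" "x \<in> PiE UNIV U" "PiE UNIV U \<subseteq> A"
    using AB(3) unfolding openin_product_topology_alt by auto
  \<comment> \<open>Index \<open>0\<close> is added so that \<open>y 0\<close> is available as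
    filler even if no entry is restricted.\<close>
  define J where "J = insert 0 {i. U i \<noteq> UNIV}"
  define T where "T = (\<Inter>i\<in>J. {z \<in> topspace Z. \<mu> z \<inter> U i \<noteq> {}}) \<inter> B"
  have "openin Z T"
    unfolding T_def using U(1,2) AB(2) lsc
    by (intro openin_Int openin_Inter) (auto simp: J_def)
  moreover have "z \<in> T"
    using AB(4) z x(1) U(3) by (fastforce simp: T_def PiE_iff)
  moreover have "T \<subseteq> {z \<in> topspace Z. \<exists>x. range x \<subseteq> \<mu> z \<and> (x, z) \<in> W}"
  proof
    fix w assume w: "w \<in> T"
    then have "\<exists>y. y \<in> \<mu> w \<inter> U i" if "i \<in> J" for i
      using that unfolding T_def by blast
    then obtain y where y: "\<And>i. i \<in> J \<Longrightarrow> y i \<in> \<mu> w \<inter> U i"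
      by metis
    define x' where "x' i = (if i \<in> J then y i else y 0)" for i
    have "x' i \<in> \<mu> w" "x' i \<in> U i" for i
      using y[of i] y[of 0] by (auto simp: x'_def J_def)
    then have "range x' \<subseteq> \<mu> w" "x' \<in> A"
      using U(4) by auto
    moreover have "w \<in> B" "w \<in> topspace Z"
      using w AB(2) openin_subset unfolding T_def by blast+
    ultimately show "w \<in> {z \<in> topspace Z. \<exists>x. range x \<subseteq> \<mu> z \<and> (x, z) \<in> W}"
      using AB(5) by blast
  qed
  ultimately show "\<exists>T. openin Z T \<and> z \<in> T \<and> T \<subseteq> {z \<in> topspace Z. \<exists>x. range x \<subseteq> \<mu> z \<and> (x, z) \<in> W}"
    by blast
qed

text \<open>Meeting \<open>U\<close> means that some sequence in the universe has its profile in
  \<open>U\<close>. This is an open condition on sequence and code, and the universe varies lower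
  semicontinuously with the code.\<close>

lemma openin_profiles_meets:
  assumes "open U"
  shows "openin (structure_topology :: 'u::metric_space structure_code topology)
    {A \<in> compact_structures. profiles A \<inter> U \<noteq> {}}"
proof -
  let ?Z = "structure_topology :: 'u structure_code topology"
  have "openin ?Z {A \<in> topspace ?Z. fst A \<inter> V \<noteq> {}}" if "open V" for V
  proof -
    have "continuous_map ?Z (vietoris euclidean) fst"
      unfolding structure_topology_def
      by (intro continuous_map_from_subtopology continuous_map_fst)
    from openin_continuous_map_preimage[OF this openin_vietoris_meets[of euclidean V]]
    have "openin ?Z {A \<in> topspace ?Z. fst A \<in> {K. compactin euclidean K \<and> K \<inter> V \<noteq> {}}}"
      using that by simp
    also have "{A \<in> topspace ?Z. fst A \<in> {K. compactin euclidean K \<and> K \<inter> V \<noteq> {}}}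
        = {A \<in> topspace ?Z. fst A \<inter> V \<noteq> {}}"
      by (auto simp: topspace_structure_topology compact_structures_def)
    finally show ?thesis .
  qed
  moreover have "openin (prod_topology euclidean ?Z)
      {z \<in> topspace (prod_topology euclidean ?Z). (\<lambda>(x, A). profile A x) z \<in> U}"
    using assms by (intro openin_continuous_map_preimage[OF continuous_map_profile]) simp
  ultimately have "openin ?Z {A \<in> topspace ?Z. \<exists>x. range x \<subseteq> fst A \<and>
      (x, A) \<in> {z \<in> topspace (prod_topology euclidean ?Z). (\<lambda>(x, A). profile A x) z \<in> U}}"
    by (rule openin_exists_sequence)
  also have "{A \<in> topspace ?Z. \<exists>x. range x \<subseteq> fst A \<and>
      (x, A) \<in> {z \<in> topspace (prod_topology euclidean ?Z). (\<lambda>(x, A). profile A x) z \<in> U}}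
    = {A \<in> compact_structures. profiles A \<inter> U \<noteq> {}}"
  proof -
    have "profiles A \<inter> U \<noteq> {} \<longleftrightarrow> (\<exists>x. range x \<subseteq> fst A \<and> profile A x \<in> U)" for A :: "'u structure_code"
      unfolding profiles_def by blast
    then show ?thesis
      by (simp add: topspace_structure_topology cong: conj_cong)
  qed
  finally show ?thesis .
qed

text \<open>By Tychonoff the sequences in a compact universe form a compact space, on which the
  profile is continuous.\<close>

lemma compact_profiles:
  assumes A: "A \<in> compact_structures"
  shows "compact (profiles A)"
proof -
  have "compact (fst A)"
    using A by (auto simp: compact_structures_def)
  then have "compactin (product_topology (\<lambda>_ :: nat. euclidean) UNIV) (PiE UNIV (\<lambda>_. fst A))"
    by (simp add: compactin_PiE)
  moreover have "PiE UNIV (\<lambda>_ :: nat. fst A) = {x. range x \<subseteq> fst A}"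
    by auto
  ultimately have "compact {x :: nat \<Rightarrow> _. range x \<subseteq> fst A}"
    by (simp add: euclidean_product_topology)
  moreover have "continuous_on UNIV (profile A)"
  proof -
    have "continuous_map euclidean (prod_topology euclidean structure_topology) (\<lambda>x. (x, A))"
      using A by (simp add: continuous_map_pairedI topspace_structure_topology)
    from continuous_map_compose[OF this continuous_map_profile] show ?thesis
      by (simp add: o_def)
  qed
  ultimately show ?thesis
    unfolding profiles_def by (meson compact_continuous_image continuous_on_subset top_greatest)
qed

section \<open>Invariance of profiles under isomorphism\<close>

text \<open>An isomorphism carries \<open>R k\<close> onto \<open>S k\<close> and preserves sum
  distances, so both infima are taken over the same set of numbers.\<close>

lemma profile_image:
  assumes A: "A \<in> compact_structures" and B: "B \<in> compact_structures"
    and iso: "isometric_isomorphism A B \<phi>" and x: "range x \<subseteq> fst A"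
  shows "profile B (\<lambda>n. \<phi> (x n)) = profile A x"
proof -
  obtain M R N S where AB: "A = (M, R)" "B = (N, S)"
    by fastforce
  have bij: "bij_betw \<phi> M N" and iso: "\<And>x y. x \<in> M \<Longrightarrow> y \<in> M \<Longrightarrow> dist (\<phi> x) (\<phi> y) = dist x y"
    and rel: "\<And>k x. 1 \<le> k \<Longrightarrow> x \<in> {1..k} \<rightarrow>\<^sub>E M \<Longrightarrow> x \<in> R k \<longleftrightarrow> (\<lambda>i\<in>{1..k}. \<phi> (x i)) \<in> S k"
    using iso unfolding AB isometric_isomorphism_def by auto
  have xM: "x n \<in> M" for n
    using x by (auto simp: AB)
  have "trunc_infdist (sum_dist k) (subtuple (\<lambda>n. \<phi> (x n)) l) (S k)
      = trunc_infdist (sum_dist k) (subtuple x l) (R k)"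
    if l: "l \<noteq> []" "k = length l" for l k
  proof -
    have k: "1 \<le> k"
      using l by (simp add: Suc_leI)
    note R = relation_subset_PiE[OF A[unfolded AB] k] and S = relation_subset_PiE[OF B[unfolded AB] k]
    have S_eq: "S k = (\<lambda>r. \<lambda>i\<in>{1..k}. \<phi> (r i)) ` R k"
    proof
      show "(\<lambda>r. \<lambda>i\<in>{1..k}. \<phi> (r i)) ` R k \<subseteq> S k"
        using rel[OF k] R by blast
      show "S k \<subseteq> (\<lambda>r. \<lambda>i\<in>{1..k}. \<phi> (r i)) ` R k"
      proof
        fix s assume s: "s \<in> S k"
        define r where "r = (\<lambda>i\<in>{1..k}. inv_into M \<phi> (s i))"
        have sN: "s \<in> {1..k} \<rightarrow>\<^sub>E N"
          using S s by blast
        have \<psi>: "inv_into M \<phi> y \<in> M" "\<phi> (inv_into M \<phi> y) = y" if "y \<in> N" for y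
          using bij that bij_betw_inv_into bij_betwE bij_betw_inv_into_right by metis+
        have r: "r \<in> {1..k} \<rightarrow>\<^sub>E M"
          using sN \<psi>(1) by (auto simp: r_def PiE_iff)
        moreover have "(\<lambda>i\<in>{1..k}. \<phi> (r i)) = s"
          using sN \<psi>(2) by (auto simp: r_def fun_eq_iff PiE_iff extensional_def)
        ultimately show "s \<in> (\<lambda>r. \<lambda>i\<in>{1..k}. \<phi> (r i)) ` R k"
          using rel[OF k r] s by (metis imageI)
      qed
    qed
    have "sum_dist k (subtuple (\<lambda>n. \<phi> (x n)) l) (\<lambda>i\<in>{1..k}. \<phi> (r i)) = sum_dist k (subtuple x l) r"
      if "r \<in> R k" for r
      unfolding sum_dist_def
    proof (rule sum.cong)
      fix i assume i: "i \<in> {1..k}"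
      moreover have "r i \<in> M"
        using R that i by blast
      ultimately show "dist (subtuple (\<lambda>n. \<phi> (x n)) l i) ((\<lambda>i\<in>{1..k}. \<phi> (r i)) i) = dist (subtuple x l i) (r i)"
        using iso[OF xM] l(2) by (simp add: subtuple_def)
    qed simp
    then have "sum_dist k (subtuple (\<lambda>n. \<phi> (x n)) l) ` S k = sum_dist k (subtuple x l) ` R k"
      unfolding S_eq image_image by (rule image_cong[OF refl])
    then show ?thesis
      unfolding trunc_infdist_def by simp
  qed
  then show ?thesis
    using iso[OF xM xM] by (simp add: profile_def AB fun_eq_iff)
qed

section \<open>Recovering a structure from its profiles\<close>

text \<open>The truncated distance to \<open>K\<close> is 1-Lipschitz for the sum distance, which
  tends to zero under coordinatewise convergence.\<close>

lemma tendsto_trunc_sum_dist: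
  assumes "\<And>i. i \<in> {1..k} \<Longrightarrow> (\<lambda>n. q n i) \<longlonglongrightarrow> p i"
  shows "(\<lambda>n. trunc_infdist (sum_dist k) (q n) K) \<longlonglongrightarrow> trunc_infdist (sum_dist k) p K"
proof -
  have le: "trunc_infdist (sum_dist k) p K \<le> sum_dist k p q + trunc_infdist (sum_dist k) q K" for p q :: "nat \<Rightarrow> 'a"
    by (intro trunc_infdist_le_add sum_dist_nonneg sum_dist_triangle)
  have bound: "norm (trunc_infdist (sum_dist k) (q n) K - trunc_infdist (sum_dist k) p K) \<le> sum_dist k (q n) p" for n
    using le[of p "q n"] le[of "q n" p] sum_dist_commute[of k p "q n"] by (simp add: abs_le_iff)
  have "(\<lambda>n. sum_dist k (q n) p) \<longlonglongrightarrow> (\<Sum>i\<in>{1..k}. 0)"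
    unfolding sum_dist_def using assms by (intro tendsto_sum tendsto_dist_iff[THEN iffD1])
  then have "(\<lambda>n. sum_dist k (q n) p) \<longlonglongrightarrow> 0"
    by (simp only: sum.neutral_const)
  then have "(\<lambda>n. trunc_infdist (sum_dist k) (q n) K - trunc_infdist (sum_dist k) p K) \<longlonglongrightarrow> 0"
    by (rule Lim_null_comparison[OF always_eventually, rotated]) (intro allI bound)
  then show ?thesis
    by (rule LIM_zero_cancel)
qed

text \<open>The relation is compact, so a zero infimum is attained, and on extensional tuples zero
  sum distance means equality.\<close>

lemma in_relation_iff_trunc_infdist:
  assumes "(M, R) \<in> compact_structures" and k: "1 \<le> k" and p: "p \<in> extensional {1..k}"
  shows "p \<in> R k \<longleftrightarrow> trunc_infdist (sum_dist k) p (R k) = 0"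
proof -
  let ?P = "power_topology (euclidean :: 'a topology) k"
  note R = compactin_power_topology_relation[OF assms(1) k]
  have "p \<in> topspace ?P"
    using p by (simp add: PiE_iff)
  then have "continuous_map ?P (prod_topology ?P ?P) (\<lambda>r. (p, r))"
    by (simp add: continuous_map_pairedI)
  from continuous_map_compose[OF this continuous_map_sum_dist]
  have "continuous_map ?P euclideanreal (sum_dist k p)"
    by (simp add: o_def)
  then have "compact (sum_dist k p ` R k)"
    using image_compactin[OF R, of euclidean "sum_dist k p"] by simp
  then have "trunc_infdist (sum_dist k) p (R k) = 0 \<longleftrightarrow> (\<exists>r\<in>R k. sum_dist k p r = 0)"
    by (intro trunc_infdist_eq_0_iff sum_dist_nonneg compact_imp_closed)
  moreover have "r \<in> extensional {1..k}" if "r \<in> R k" for r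
    using relation_subset_PiE[OF assms(1) k] that by (auto simp: PiE_iff)
  ultimately show ?thesis
    using sum_dist_eq_0_iff[OF p] by metis
qed

text \<open>Equal profiles make the assignment of \<open>y i\<close> to \<open>x i\<close> an
  isometry, which extends to the closure. Relations transfer because membership means zero distance,
  and the distance of any tuple is a limit of distances recorded in the common profile.\<close>

lemma embedding_of_profile:
  fixes M N :: "'u::polish_space set"
  assumes A: "(M, R) \<in> compact_structures" and B: "(N, S) \<in> compact_structures"
    and x: "range x \<subseteq> M" "M \<subseteq> closure (range x)" and y: "range y \<subseteq> N"
    and eq: "profile (M, R) x = profile (N, S) y"
  obtains \<phi> where "\<phi> ` M \<subseteq> N"
    and "\<And>p q. p \<in> M \<Longrightarrow> q \<in> M \<Longrightarrow> dist (\<phi> p) (\<phi> q) = dist p q"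
    and "\<And>k p. 1 \<le> k \<Longrightarrow> p \<in> {1..k} \<rightarrow>\<^sub>E M \<Longrightarrow> p \<in> R k \<longleftrightarrow> (\<lambda>i\<in>{1..k}. \<phi> (p i)) \<in> S k"
proof -
  have dist_eq: "dist (x i) (x j) = dist (y i) (y j)" for i j
    using fun_cong[OF arg_cong[OF eq, of fst], of "(i, j)"] by (simp add: profile_def)
  have rel_eq: "trunc_infdist (sum_dist (length l)) (subtuple x l) (R (length l))
      = trunc_infdist (sum_dist (length l)) (subtuple y l) (S (length l))" if "l \<noteq> []" for l
    using fun_cong[OF arg_cong[OF eq, of snd], of l] that by (simp add: profile_def)
  define f where "f p = y (SOME i. x i = p)" for p
  have fx: "f (x i) = y i" for i
  proof -
    have "x (SOME j. x j = x i) = x i"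
      by (rule someI) (rule refl)
    then have "dist (y (SOME j. x j = x i)) (y i) = 0"
      using dist_eq by (metis dist_self)
    then show ?thesis
      by (simp add: f_def)
  qed
  have "uniformly_continuous_on (range x) f"
    unfolding uniformly_continuous_on_def by (auto simp: fx dist_eq)
  then obtain \<phi> where uc: "uniformly_continuous_on (closure (range x)) \<phi>"
    and \<phi>f: "\<And>p. p \<in> range x \<Longrightarrow> f p = \<phi> p"
    using uniformly_continuous_on_extension_on_closure by metis
  have \<phi>x: "\<phi> (x i) = y i" for i
    using \<phi>f fx by (metis rangeI)
  have cont: "continuous_on (closure (range x)) \<phi>"
    using uc by (rule uniformly_continuous_imp_continuous)
  have "compact N"
    using B by (auto simp: compact_structures_def)
  then have "\<phi> ` closure (range x) \<subseteq> N"
    using y by (intro image_closure_subset[OF cont]) (auto simp: compact_imp_closed \<phi>x)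
  then have 1: "\<phi> ` M \<subseteq> N"
    using x(2) by blast
  have approx: "\<exists>a. (\<lambda>n. x (a n)) \<longlonglongrightarrow> p \<and> (\<lambda>n. y (a n)) \<longlonglongrightarrow> \<phi> p" if "p \<in> M" for p
  proof -
    have p: "p \<in> closure (range x)"
      using that x(2) by blast
    then obtain u where u: "\<And>n. u n \<in> range x" "u \<longlonglongrightarrow> p"
      by (auto simp: closure_sequential)
    then have "\<exists>i. u n = x i" for n
      by blast
    then obtain a where a: "u = (\<lambda>n. x (a n))"
      by metis
    have "(\<lambda>n. \<phi> (u n)) \<longlonglongrightarrow> \<phi> p"
      using cont p u closure_subset unfolding continuous_on_sequentially o_def by blast
    then show ?thesis
      using u(2) unfolding a \<phi>x by blast
  qed
  have 2: "dist (\<phi> p) (\<phi> q) = dist p q" if "p \<in> M" "q \<in> M" for p q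
  proof -
    obtain a b where "(\<lambda>n. x (a n)) \<longlonglongrightarrow> p" "(\<lambda>n. y (a n)) \<longlonglongrightarrow> \<phi> p"
      "(\<lambda>n. x (b n)) \<longlonglongrightarrow> q" "(\<lambda>n. y (b n)) \<longlonglongrightarrow> \<phi> q"
      using approx \<open>p \<in> M\<close> \<open>q \<in> M\<close> by meson
    then have "(\<lambda>n. dist (x (a n)) (x (b n))) \<longlonglongrightarrow> dist p q"
      "(\<lambda>n. dist (y (a n)) (y (b n))) \<longlonglongrightarrow> dist (\<phi> p) (\<phi> q)"
      by (simp_all only: tendsto_dist)
    then show ?thesis
      unfolding dist_eq using LIMSEQ_unique by blast
  qed
  have 3: "p \<in> R k \<longleftrightarrow> (\<lambda>i\<in>{1..k}. \<phi> (p i)) \<in> S k" if k: "1 \<le> k" and p: "p \<in> {1..k} \<rightarrow>\<^sub>E M" for k p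
  proof -
    have "\<exists>a. (\<lambda>n. x (a n)) \<longlonglongrightarrow> p i \<and> (\<lambda>n. y (a n)) \<longlonglongrightarrow> \<phi> (p i)" if "i \<in> {1..k}" for i
      using approx p that by blast
    then obtain a where a: "\<And>i. i \<in> {1..k} \<Longrightarrow> (\<lambda>n. x (a i n)) \<longlonglongrightarrow> p i"
      "\<And>i. i \<in> {1..k} \<Longrightarrow> (\<lambda>n. y (a i n)) \<longlonglongrightarrow> \<phi> (p i)"
      by metis
    \<comment> \<open>The index list follows the approximations at stage \<open>n\<close>.
      Coordinate \<open>i\<close> of the tuple sits at list position \<open>i - 1\<close>, which
      matches the shift in \<open>subtuple\<close>.\<close>
    define l where "l n = map (\<lambda>i. a i n) [1..<Suc k]" for n
    have len: "length (l n) = k" "l n \<noteq> []" for n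
      using k by (auto simp: l_def)
    have sub: "subtuple z (l n) i = z (a i n)" if "i \<in> {1..k}" for n i and z :: "nat \<Rightarrow> 'u"
      using that len(1)[of n] by (auto simp: subtuple_def l_def simp del: upt_Suc)
    have "(\<lambda>n. trunc_infdist (sum_dist k) (subtuple x (l n)) (R k)) \<longlonglongrightarrow> trunc_infdist (sum_dist k) p (R k)"
      by (intro tendsto_trunc_sum_dist) (simp add: sub a)
    moreover have "(\<lambda>n. trunc_infdist (sum_dist k) (subtuple y (l n)) (S k))
        \<longlonglongrightarrow> trunc_infdist (sum_dist k) (\<lambda>i\<in>{1..k}. \<phi> (p i)) (S k)"
      by (intro tendsto_trunc_sum_dist) (simp add: sub a)
    moreover have "trunc_infdist (sum_dist k) (subtuple x (l n)) (R k)
        = trunc_infdist (sum_dist k) (subtuple y (l n)) (S k)" for n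
      using rel_eq[OF len(2), of n] by (simp add: len(1))
    ultimately have "trunc_infdist (sum_dist k) p (R k)
        = trunc_infdist (sum_dist k) (\<lambda>i\<in>{1..k}. \<phi> (p i)) (S k)"
      using LIMSEQ_unique by simp
    moreover have "p \<in> extensional {1..k}"
      using p by (simp add: PiE_iff)
    ultimately show ?thesis
      using in_relation_iff_trunc_infdist[OF A k] in_relation_iff_trunc_infdist[OF B k]
      by (metis restrict_extensional)
  qed
  show ?thesis
    using that 1 2 3 by blast
qed

text \<open>The profile of a dense sequence of \<open>M\<close> is also the profile of some sequence
  in \<open>N\<close>.\<close>

lemma embedding_of_profiles:
  fixes M N :: "'u::polish_space set"
  assumes A: "(M, R) \<in> compact_structures" and B: "(N, S) \<in> compact_structures"
    and sub: "profiles (M, R) \<subseteq> profiles (N, S)"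
  obtains \<phi> where "\<phi> ` M \<subseteq> N"
    and "\<And>p q. p \<in> M \<Longrightarrow> q \<in> M \<Longrightarrow> dist (\<phi> p) (\<phi> q) = dist p q"
    and "\<And>k p. 1 \<le> k \<Longrightarrow> p \<in> {1..k} \<rightarrow>\<^sub>E M \<Longrightarrow> p \<in> R k \<longleftrightarrow> (\<lambda>i\<in>{1..k}. \<phi> (p i)) \<in> S k"
proof (cases "M = {}")
  \<comment> \<open>An empty \<open>M\<close> contains no sequence, but its powers of positive
    exponent are empty, so any map works.\<close>
  case True
  then have "{1..k} \<rightarrow>\<^sub>E M = {}" if "1 \<le> k" for k :: nat
    using that True by (intro PiE_eq_empty_iff[THEN iffD2] bexI[of _ 1]) simp_all
  then show ?thesis
    using that[of "\<lambda>x. x"] True by blast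
next
  case False
  have "separable_space (top_of_set M)"
    by (intro second_countable_imp_separable_space second_countable_subtopology second_countable_euclidean)
  then obtain C where C: "countable C" "C \<subseteq> M" "top_of_set M closure_of C = M"
    unfolding separable_space_def by auto
  then have "M \<subseteq> closure C"
    using closure_mono[of "M \<inter> C" C] by (auto simp: closure_of_subtopology)
  moreover have "C \<noteq> {}"
    using C(3) False by auto
  ultimately have x: "range (from_nat_into C) \<subseteq> M" "M \<subseteq> closure (range (from_nat_into C))"
    using C(1,2) by simp_all
  then have "profile (M, R) (from_nat_into C) \<in> profiles (N, S)"
    using sub by (auto simp: profiles_def)
  then obtain y where "range y \<subseteq> N" "profile (M, R) (from_nat_into C) = profile (N, S) y"
    by (auto simp: profiles_def)
  then show ?thesis
    using embedding_of_profile[OF A B x] that by metis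
qed

text \<open>An isomorphism transports sequences together with their profiles. Conversely, equal
  profiles give embeddings both ways, and compactness makes one of them onto.\<close>

lemma isometric_isomorphism_relation_iff_profiles:
  fixes A B :: "'u::polish_space structure_code"
  assumes A: "A \<in> compact_structures" and B: "B \<in> compact_structures"
  shows "(A, B) \<in> isometric_isomorphism_relation \<longleftrightarrow> profiles A = profiles B"
proof
  have sub: "profiles C \<subseteq> profiles D" if "(C, D) \<in> isometric_isomorphism_relation" for C D :: "'u structure_code"
  proof -
    obtain \<phi> where CD: "C \<in> compact_structures" "D \<in> compact_structures" and iso: "isometric_isomorphism C D \<phi>"
      using \<open>(C, D) \<in> isometric_isomorphism_relation\<close> unfolding isometric_isomorphism_relation_def by blast
    have "\<phi> ` fst C \<subseteq> fst D"
      using iso by (cases C; cases D) (auto simp: isometric_isomorphism_def bij_betw_def)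
    show ?thesis
    proof
      fix P assume "P \<in> profiles C"
      then obtain x where x: "range x \<subseteq> fst C" "P = profile C x"
        unfolding profiles_def by blast
      then have "range (\<lambda>n. \<phi> (x n)) \<subseteq> fst D" "P = profile D (\<lambda>n. \<phi> (x n))"
        using \<open>\<phi> ` fst C \<subseteq> fst D\<close> profile_image[OF CD iso x(1)] by auto
      then show "P \<in> profiles D"
        unfolding profiles_def by blast
    qed
  qed
  assume "(A, B) \<in> isometric_isomorphism_relation"
  moreover from this have "(B, A) \<in> isometric_isomorphism_relation"
    using equiv_isometric_isomorphism_relation by (meson equivE symE)
  ultimately show "profiles A = profiles B"
    using sub by blast
next
  assume eq: "profiles A = profiles B"
  obtain M R N S where AB: "A = (M, R)" "B = (N, S)"
    by fastforce
  obtain \<phi> where \<phi>: "\<phi> ` M \<subseteq> N" "\<And>p q. p \<in> M \<Longrightarrow> q \<in> M \<Longrightarrow> dist (\<phi> p) (\<phi> q) = dist p q"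
    and "\<And>k p. 1 \<le> k \<Longrightarrow> p \<in> {1..k} \<rightarrow>\<^sub>E M \<Longrightarrow> p \<in> R k \<longleftrightarrow> (\<lambda>i\<in>{1..k}. \<phi> (p i)) \<in> S k"
    using embedding_of_profiles[OF A[unfolded AB] B[unfolded AB]] eq unfolding AB by blast
  obtain \<psi> where \<psi>: "\<psi> ` N \<subseteq> M" "\<And>p q. p \<in> N \<Longrightarrow> q \<in> N \<Longrightarrow> dist (\<psi> p) (\<psi> q) = dist p q"
    and rel: "\<And>k p. 1 \<le> k \<Longrightarrow> p \<in> {1..k} \<rightarrow>\<^sub>E N \<Longrightarrow> p \<in> S k \<longleftrightarrow> (\<lambda>i\<in>{1..k}. \<psi> (p i)) \<in> R k"
    using embedding_of_profiles[OF B[unfolded AB] A[unfolded AB]] eq unfolding AB by blast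
  have "compact M"
    using A by (auto simp: AB compact_structures_def)
  then have "(\<lambda>x. \<psi> (\<phi> x)) ` M = M"
    using \<phi> \<psi> by (intro isometric_self_embedding_onto) (auto simp: image_subset_iff)
  \<comment> \<open>The composite is onto, and its image is contained in that of
    \<open>\<psi>\<close>.\<close>
  then have "\<psi> ` N = M"
    using \<phi>(1) \<psi>(1) by blast
  moreover have "inj_on \<psi> N"
    using \<psi>(2) by (metis dist_eq_0_iff inj_onI)
  ultimately have "isometric_isomorphism B A \<psi>"
    using \<psi>(2) rel by (simp add: AB isometric_isomorphism_def bij_betw_def)
  then show "(A, B) \<in> isometric_isomorphism_relation"
    using isometric_isomorphism_sym A B unfolding isometric_isomorphism_relation_def by blast
qed

section \<open>The Borel reduction\<close>

text \<open>Missing an open set means missing all basic sets that make it up. Applied to the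
  complement of either closed set, this shows that each contains the other.\<close>

lemma closed_eq_if_meet_same_basic_sets:
  assumes B: "topological_basis B" and "closed P" "closed Q"
    and meet: "\<And>U. U \<in> B \<Longrightarrow> P \<inter> U = {} \<longleftrightarrow> Q \<inter> U = {}"
  shows "P = Q"
proof -
  have "P \<inter> U = {} \<longleftrightarrow> Q \<inter> U = {}" if "open U" for U
  proof -
    obtain \<U> where "\<U> \<subseteq> B" "\<Union>\<U> = U"
      using B \<open>open U\<close> unfolding topological_basis_def by blast
    then show ?thesis
      using meet by (auto simp: Int_Union)
  qed
  from this[of "- P"] this[of "- Q"] show ?thesis
    using assms(2,3) by auto
qed

theorem theorem8p1:
  assumes "urysohn_space TYPE('u::polish_space)"
  shows "smooth_equivalence (borel_of (structure_topology :: 'u structure_code topology))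
           isometric_isomorphism_relation"
proof -
  let ?X = "borel_of (structure_topology :: 'u structure_code topology)"
  obtain B :: "((nat \<times> nat \<Rightarrow> real) \<times> (nat list \<Rightarrow> real)) set set"
    where B: "countable B" "topological_basis B"
    using ex_countable_basis by blast
  have "B \<noteq> {}"
    using B(2) by (metis UNIV_I empty_iff open_UNIV topological_basisE)
  have B_open: "open U" if "U \<in> B" for U
    using B(2) that topological_basis_open by blast
  \<comment> \<open>Coordinate \<open>n\<close> records whether the profiles meet the
    \<open>n\<close>-th basic open set. This is the indicator of an open set of codes, hence
    Borel.\<close>
  define f :: "'u structure_code \<Rightarrow> nat \<Rightarrow> real"
    where "f A n = indicator {A \<in> compact_structures. profiles A \<inter> from_nat_into B n \<noteq> {}} A" for A n
  have "(\<lambda>A. f A n) \<in> borel_measurable ?X" for n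
    unfolding f_def
    by (intro borel_measurable_indicator sets_borel_of openin_profiles_meets B_open from_nat_into \<open>B \<noteq> {}\<close>)
  then have "f \<in> ?X \<rightarrow>\<^sub>M borel_of euclidean"
    unfolding borel_of_euclidean by (rule measurable_coordinatewise_then_product)
  moreover have "(A, A') \<in> isometric_isomorphism_relation \<longleftrightarrow> f A = f A'"
    if A: "A \<in> compact_structures" and A': "A' \<in> compact_structures" for A A'
  proof -
    have "profiles A = profiles A'" if eq: "f A = f A'"
    proof (rule closed_eq_if_meet_same_basic_sets[OF B(2)])
      fix U assume "U \<in> B"
      then have "from_nat_into B (to_nat_on B U) = U"
        using B(1) by simp
      with fun_cong[OF eq, of "to_nat_on B U"] show "profiles A \<inter> U = {} \<longleftrightarrow> profiles A' \<inter> U = {}"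
        using A A' by (auto simp: f_def indicator_def split: if_splits)
    qed (use A A' compact_profiles compact_imp_closed in blast)+
    moreover have "f A = f A'" if "profiles A = profiles A'"
      using that A A' by (simp add: f_def fun_eq_iff indicator_def)
    ultimately show ?thesis
      using isometric_isomorphism_relation_iff_profiles[OF A A'] by blast
  qed
  moreover have "standard_borel ?X"
    unfolding standard_borel_def
    by (intro exI[of _ structure_topology] conjI polish_topology_structure_topology space_borel_of refl)
  ultimately show ?thesis
    unfolding smooth_equivalence_def space_borel_of topspace_structure_topology
    by (intro conjI exI[of _ euclidean] exI[of _ f] ballI
        equiv_isometric_isomorphism_relation polish_topology_euclidean)
qed

end
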